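(* Let $\Omega\subseteq\mathbb{R}^s$, let $\pi$ be a probability density on $\Omega$, and let $\phi:\Omega\times[0,1]^d\to\Omega$ (with $s\le d$) be the update function of a regular MCMC with stationary distribution $\pi$. Suppose that $\phi$ has a coupling region $\mathcal{C}\subset[0,1]^d$. Let $\bm{x}_0\in\Omega$ and, for $i\ge 1$, let $\bm{x}_i=\phi(\bm{x}_{i-1},\bm{u}_i)$. If $\bm{u}_i=(v_{d(i-1)+1},\ldots,v_{di})$ for all $i\ge1$, where $(v_i)_{i\ge 1}$ is a completely uniformly distributed (CUD) sequence in $[0,1]$, then the sequence $\bm{x}_1,\bm{x}_2,\ldots$ consistently samples $\pi$.
   Context: **Update function.** $\pi$ is a probability density with respect to Lebesgue measure on $\Omega\subseteq\mathbb{R}^s$. An MCMC update function for $\pi$ is a measurable map $\phi:\Omega\times[0,1]^d\to\Omega$ for which $\pi$ is stationary: if $\bm{x}\sim\pi$ and $\bm{u}\sim U[0,1]^d$ are independent, then $\phi(\bm{x},\bm{u})\sim\pi$. **Star discrepancy and CUD.** For $\bm{y}_1,\ldots,\bm{y}_n\in[0,1]^k$, the star discrepancy is $$D_n^{*k}(\bm{y}_1,\ldots,\bm{y}_n)=\sup_{\bm{a}\in[0,1]^k}\Bigl|\frac1n\sum_{i=1}^n 1_{[\bm{0},\bm{a})}(\bm{y}_i)-\prod_{j=1}^k a_j\Bigr|.$$ A sequence $v_1,v_2,\ldots\in[0,1]$ is completely uniformly distributed (CUD) if for every $k\ge1$ the points $\bm{y}_i^{(k)}=(v_i,\ldots,v_{i+k-1})$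 satisfy $D_n^{*k}(\bm{y}_1^{(k)},\ldots,\bm{y}_n^{(k)})\to0$ as $n\to\infty$. **Inverse Rosenblatt transformation.** Let $F_1$ be the marginal CDF of $x_1$ and $F_j(\cdot\,;x_1,\ldots,x_{j-1})$ the conditional CDF of $x_j$ given $x_1,\ldots,x_{j-1}$ (a fixed version) when $\bm{x}=(x_1,\ldots,x_s)\sim\pi$. For a CDF $F$ on $\mathbb{R}$ and $0<u<1$, $F^{-1}(u)=\inf\{x: F(x)\ge u\}$, with $F^{-1}(0)$ and $F^{-1}(1)$ defined by one-sided limits (in the extended reals if necessary). For $\bm{u}\in[0,1]^s$, $\psi_R(\bm{u})=\bm{x}$ where $x_1=F_1^{-1}(u_1)$ and $x_j=F_j^{-1}(u_j;x_1,\ldots,x_{j-1})$ for $2\le j\le s$. It is understood that $\psi_R(\bm{u})\in\Omega$ for $\bm{u}\in(0,1)^s$; points of the boundary of the cube, where infinite values may occur, are immaterial for Riemann integrability (there the functions below may be given arbitrary bounded values). **Rosenblatt–Chentsov transformation.** For $\bm{u}_0,\ldots,\bm{u}_m\in[0,1]^d$ it is the sequence $\bm{x}_0,\ldots,\bm{x}_m\in\Omega$ where $\bm{x}_0=\psi_R$ applied to the first $s$ components of $\bm{u}_0$, and $\bm{x}_i=\phi(\bm{x}_{i-1},\bm{u}_i)$ for $i=1,\ldots,m$. Write $\bm{x}_m(\bm{u}_0,\ldots,\bm{u}_m)$ for the last point. **Regular MCMC.** The MCMC is regular if, for every integer $m\ge0$ and every bounded continuous $f:\Omega\to\mathbb{R}$,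 the function $(\bm{u}_0,\ldots,\bm{u}_m)\mapsto f(\bm{x}_m(\bm{u}_0,\ldots,\bm{u}_m))$ is (properly) Riemann integrable on $[0,1]^{d(m+1)}$. **Coupling region.** A set $\mathcal{C}\subset[0,1]^d$ that is Jordan measurable with positive Jordan measure is a coupling region for $\phi$ if $\bm{u}\in\mathcal{C}$ implies $\phi(\bm{x},\bm{u})=\phi(\bm{x}',\bm{u})$ for all $\bm{x},\bm{x}'\in\Omega$. **Consistency.** A sequence $\bm{x}_1,\bm{x}_2,\ldots\in\Omega$ consistently samples $\pi$ if $\lim_{n\to\infty}\frac1n\sum_{i=1}^n f(\bm{x}_i)=\int_\Omega f(\bm{x})\pi(\bm{x})\,d\bm{x}$ for all bounded continuous $f:\Omega\to\mathbb{R}$. *)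

theory Defs
  imports "HOL-Probability.Probability"
begin

text \<open>
  The dimensions \<open>k\<close>, \<open>d * (m + 1)\<close> and \<open>j < s\<close> all vary inside the definitions, so a point of
  \<open>\<real>\<^sup>n\<close> is an extensional function in \<open>{..<n} \<rightarrow>\<^sub>E UNIV\<close>, with coordinates counted from 0.
  \<open>continuous_on\<close> on a set of such points refers to the product topology on \<open>nat \<Rightarrow> real\<close>, which
  induces on \<open>{..<n} \<rightarrow>\<^sub>E UNIV\<close> the Euclidean topology of \<open>\<real>\<^sup>n\<close>, since the coordinates
  \<open>i \<ge> n\<close> are all fixed to \<open>undefined\<close>.
\<close>

type_synonym point = "nat \<Rightarrow> real"

definition leb :: "nat \<Rightarrow> point measure" where
  "leb n = (\<Pi>\<^sub>M i\<in>{..<n}. lborel)"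

definition cube :: "nat \<Rightarrow> point set" where
  "cube n = ({..<n} \<rightarrow>\<^sub>E {0..1})"

definition uniform_cube :: "nat \<Rightarrow> point measure" where
  "uniform_cube n = (\<Pi>\<^sub>M i\<in>{..<n}. restrict_space lborel {0..1})"


subsection \<open>Riemann integral on the unit cube and Jordan measure\<close>

text \<open>
  A grid on \<open>cube N\<close> divides the \<open>c\<close>-th side at \<open>0 = p c 0 < \<dots> < p c (n c) = 1\<close>; its cells are
  indexed by \<open>grid_cells N n\<close>.
\<close>

definition grid :: "nat \<Rightarrow> (nat \<Rightarrow> nat) \<Rightarrow> (nat \<Rightarrow> nat \<Rightarrow> real) \<Rightarrow> bool" where
  "grid N n p \<longleftrightarrow>
     (\<forall>c<N. p c 0 = 0 \<and> p c (n c) = 1 \<and> (\<forall>l<n c. p c l < p c (Suc l)))"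

definition grid_cells :: "nat \<Rightarrow> (nat \<Rightarrow> nat) \<Rightarrow> (nat \<Rightarrow> nat) set" where
  "grid_cells N n = (\<Pi>\<^sub>E c\<in>{..<N}. {..<n c})"

definition cell :: "nat \<Rightarrow> (nat \<Rightarrow> nat \<Rightarrow> real) \<Rightarrow> (nat \<Rightarrow> nat) \<Rightarrow> point set" where
  "cell N p \<kappa> = (\<Pi>\<^sub>E c\<in>{..<N}. {p c (\<kappa> c)..p c (Suc (\<kappa> c))})"

definition cell_volume :: "nat \<Rightarrow> (nat \<Rightarrow> nat \<Rightarrow> real) \<Rightarrow> (nat \<Rightarrow> nat) \<Rightarrow> real" where
  "cell_volume N p \<kappa> = (\<Prod>c<N. p c (Suc (\<kappa> c)) - p c (\<kappa> c))"

definition mesh_less :: "nat \<Rightarrow> (nat \<Rightarrow> nat) \<Rightarrow> (nat \<Rightarrow> nat \<Rightarrow> real) \<Rightarrow> real \<Rightarrow> bool" where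
  "mesh_less N n p \<delta> \<longleftrightarrow> (\<forall>c<N. \<forall>l<n c. p c (Suc l) - p c l < \<delta>)"

text \<open>
  Proper Riemann integral as the limit of Riemann sums over grids of vanishing mesh, with arbitrary
  tags \<open>\<tau>\<close>. The library integrals (Henstock-Kurzweil, Bochner) admit more functions.
\<close>

definition has_riemann_integral :: "nat \<Rightarrow> (point \<Rightarrow> real) \<Rightarrow> real \<Rightarrow> bool" where
  "has_riemann_integral N g I \<longleftrightarrow>
     (\<forall>\<epsilon>>0. \<exists>\<delta>>0. \<forall>n p \<tau>.
        grid N n p \<longrightarrow> mesh_less N n p \<delta> \<longrightarrow> (\<forall>\<kappa>\<in>grid_cells N n. \<tau> \<kappa> \<in> cell N p \<kappa>) \<longrightarrow>
        \<bar>(\<Sum>\<kappa>\<in>grid_cells N n. g (\<tau> \<kappa>) * cell_volume N p \<kappa>) - I\<bar> < \<epsilon>)"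

definition riemann_integrable :: "nat \<Rightarrow> (point \<Rightarrow> real) \<Rightarrow> bool" where
  "riemann_integrable N g \<longleftrightarrow> (\<exists>I. has_riemann_integral N g I)"

text \<open>\<open>C \<subseteq> cube N\<close> is Jordan measurable with Jordan measure \<open>J\<close>.\<close>

definition has_jordan_measure :: "nat \<Rightarrow> point set \<Rightarrow> real \<Rightarrow> bool" where
  "has_jordan_measure N C J \<longleftrightarrow> C \<subseteq> cube N \<and> has_riemann_integral N (indicator C) J"


subsection \<open>Star discrepancy and CUD sequences\<close>

definition anchored_box :: "nat \<Rightarrow> point \<Rightarrow> point set" where
  "anchored_box k a = (\<Pi>\<^sub>E j\<in>{..<k}. {0..<a j})"

definition star_discrepancy :: "nat \<Rightarrow> nat \<Rightarrow> (nat \<Rightarrow> point) \<Rightarrow> real" where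
  "star_discrepancy k n y =
     (SUP a\<in>cube k. \<bar>(\<Sum>i=1..n. indicator (anchored_box k a) (y i)) / real n - (\<Prod>j<k. a j)\<bar>)"

text \<open>The sequence is \<open>v 1, v 2, \<dots>\<close>; the value \<open>v 0\<close> plays no role.\<close>

definition cud :: "(nat \<Rightarrow> real) \<Rightarrow> bool" where
  "cud v \<longleftrightarrow> (\<forall>i\<ge>1. v i \<in> {0..1}) \<and>
     (\<forall>k\<ge>1. (\<lambda>n. star_discrepancy k n (\<lambda>i. \<lambda>j\<in>{..<k}. v (i + j))) \<longlonglongrightarrow> 0)"


subsection \<open>Target distribution and update functions\<close>

definition state_space :: "nat \<Rightarrow> point set \<Rightarrow> point measure" where
  "state_space s \<Omega> = restrict_space (leb s) \<Omega>"

definition target :: "nat \<Rightarrow> point set \<Rightarrow> (point \<Rightarrow> real) \<Rightarrow> point measure" where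
  "target s \<Omega> \<pi> = density (state_space s \<Omega>) (\<lambda>x. ennreal (\<pi> x))"

definition probability_density :: "nat \<Rightarrow> point set \<Rightarrow> (point \<Rightarrow> real) \<Rightarrow> bool" where
  "probability_density s \<Omega> \<pi> \<longleftrightarrow>
     \<Omega> \<in> sets (leb s) \<and> \<pi> \<in> borel_measurable (state_space s \<Omega>) \<and>
     (\<forall>x\<in>\<Omega>. 0 \<le> \<pi> x) \<and> prob_space (target s \<Omega> \<pi>)"

definition update_function ::
    "nat \<Rightarrow> nat \<Rightarrow> point set \<Rightarrow> (point \<Rightarrow> real) \<Rightarrow> (point \<Rightarrow> point \<Rightarrow> point) \<Rightarrow> bool" where
  "update_function s d \<Omega> \<pi> \<phi> \<longleftrightarrow>
     case_prod \<phi> \<in> state_space s \<Omega> \<Otimes>\<^sub>M uniform_cube d \<rightarrow>\<^sub>M state_space s \<Omega> \<and>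
     distr (target s \<Omega> \<pi> \<Otimes>\<^sub>M uniform_cube d) (state_space s \<Omega>) (case_prod \<phi>) = target s \<Omega> \<pi>"

definition coupling_region ::
    "nat \<Rightarrow> point set \<Rightarrow> (point \<Rightarrow> point \<Rightarrow> point) \<Rightarrow> point set \<Rightarrow> bool" where
  "coupling_region d \<Omega> \<phi> C \<longleftrightarrow>
     (\<exists>J>0. has_jordan_measure d C J) \<and>
     (\<forall>u\<in>C. \<forall>x\<in>\<Omega>. \<forall>x'\<in>\<Omega>. \<phi> x u = \<phi> x' u)"

definition consistently_samples ::
    "nat \<Rightarrow> point set \<Rightarrow> (point \<Rightarrow> real) \<Rightarrow> (nat \<Rightarrow> point) \<Rightarrow> bool" where
  "consistently_samples s \<Omega> \<pi> x \<longleftrightarrow>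
     (\<forall>i\<ge>1. x i \<in> \<Omega>) \<and>
     (\<forall>f :: point \<Rightarrow> real. continuous_on \<Omega> f \<and> bounded (f ` \<Omega>) \<longrightarrow>
        (\<lambda>n. (\<Sum>i=1..n. f (x i)) / real n) \<longlonglongrightarrow> (LINT y:\<Omega>|leb s. f y * \<pi> y))"


subsection \<open>Inverse Rosenblatt transformation\<close>

text \<open>
  \<open>F j z\<close> is the CDF of coordinate \<open>j\<close> given that the coordinates \<open>0, \<dots>, j - 1\<close> form the point
  \<open>z\<close>. For \<open>j = 0\<close> the conditioning sigma-algebra is trivial and \<open>F 0\<close> at the only point of
  \<open>{..<0} \<rightarrow>\<^sub>E UNIV\<close> is the marginal CDF.
\<close>

definition is_cdf :: "(real \<Rightarrow> real) \<Rightarrow> bool" where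
  "is_cdf G \<longleftrightarrow> (\<exists>M. real_distribution M \<and> G = cdf M)"

definition conditional_cdfs ::
    "nat \<Rightarrow> point measure \<Rightarrow> (nat \<Rightarrow> point \<Rightarrow> real \<Rightarrow> real) \<Rightarrow> bool" where
  "conditional_cdfs s P F \<longleftrightarrow>
     (\<forall>j<s.
        (\<forall>z\<in>{..<j} \<rightarrow>\<^sub>E UNIV. is_cdf (F j z)) \<and>
        (\<forall>t. (\<lambda>z. F j z t) \<in> borel_measurable (leb j)) \<and>
        (\<forall>t. AE x in P.
           F j (restrict x {..<j}) t =
           real_cond_exp P (vimage_algebra (space P) (\<lambda>y. restrict y {..<j}) (leb j))
             (indicator {y. y j \<le> t}) x))"

text \<open>Meaningful for \<open>0 < u < 1\<close>, where the set is nonempty and bounded below.\<close>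

definition quantile :: "(real \<Rightarrow> real) \<Rightarrow> real \<Rightarrow> real" where
  "quantile G u = Inf {t. u \<le> G t}"

text \<open>\<open>rosenblatt_prefix F u j\<close> consists of the first \<open>j\<close> coordinates of \<open>inverse_rosenblatt s F u\<close>.\<close>

primrec rosenblatt_prefix ::
    "(nat \<Rightarrow> point \<Rightarrow> real \<Rightarrow> real) \<Rightarrow> point \<Rightarrow> nat \<Rightarrow> point" where
  "rosenblatt_prefix F u 0 = (\<lambda>_. undefined)"
| "rosenblatt_prefix F u (Suc j) =
     (rosenblatt_prefix F u j)(j := quantile (F j (rosenblatt_prefix F u j)) (u j))"

definition inverse_rosenblatt ::
    "nat \<Rightarrow> (nat \<Rightarrow> point \<Rightarrow> real \<Rightarrow> real) \<Rightarrow> point \<Rightarrow> point" where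
  "inverse_rosenblatt s F u = rosenblatt_prefix F u s"

definition open_cube :: "nat \<Rightarrow> point set" where
  "open_cube n = ({..<n} \<rightarrow>\<^sub>E {0<..<1})"


subsection \<open>Rosenblatt-Chentsov transformation and regularity\<close>

primrec chentsov ::
    "nat \<Rightarrow> (nat \<Rightarrow> point \<Rightarrow> real \<Rightarrow> real) \<Rightarrow> (point \<Rightarrow> point \<Rightarrow> point) \<Rightarrow>
     (nat \<Rightarrow> point) \<Rightarrow> nat \<Rightarrow> point" where
  "chentsov s F \<phi> u 0 = inverse_rosenblatt s F (restrict (u 0) {..<s})"
| "chentsov s F \<phi> u (Suc i) = \<phi> (chentsov s F \<phi> u i) (u (Suc i))"

text \<open>
  A point \<open>w\<close> of the \<open>d * (m + 1)\<close>-dimensional cube is the concatenation of \<open>u\<^sub>0, \<dots>, u\<^sub>m\<close>, with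
  \<open>u\<^sub>i = block d w i\<close>.
\<close>

definition block :: "nat \<Rightarrow> point \<Rightarrow> nat \<Rightarrow> point" where
  "block d w i = (\<lambda>j\<in>{..<d}. w (d * i + j))"

text \<open>
  \<open>F\<close> is the chosen version of the conditional CDFs. The integrand is set to 0 where one of the
  first \<open>s\<close> components of \<open>u\<^sub>0\<close> is 0 or 1, where the inverse Rosenblatt transformation may be
  infinite or leave \<open>\<Omega>\<close>. This set has Jordan measure 0, so the bounded values chosen on it affect
  neither Riemann integrability nor the integral.
\<close>

definition regular_mcmc ::
    "nat \<Rightarrow> nat \<Rightarrow> point set \<Rightarrow> (point \<Rightarrow> real) \<Rightarrow> (point \<Rightarrow> point \<Rightarrow> point) \<Rightarrow>
     (nat \<Rightarrow> point \<Rightarrow> real \<Rightarrow> real) \<Rightarrow> bool" where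
  "regular_mcmc s d \<Omega> \<pi> \<phi> F \<longleftrightarrow>
     update_function s d \<Omega> \<pi> \<phi> \<and>
     conditional_cdfs s (target s \<Omega> \<pi>) F \<and>
     (\<forall>u\<in>open_cube s. inverse_rosenblatt s F u \<in> \<Omega>) \<and>
     (\<forall>m. \<forall>f :: point \<Rightarrow> real. continuous_on \<Omega> f \<and> bounded (f ` \<Omega>) \<longrightarrow>
        riemann_integrable (d * (m + 1))
          (\<lambda>w. if restrict (block d w 0) {..<s} \<in> open_cube s
               then f (chentsov s F \<phi> (block d w) m) else 0))"

end

theory Submission
  imports Defs
begin

text \<open>
  Fix a bounded continuous \<open>f\<close>. The coupling region contains a grid cell of volume \<open>c > 0\<close>, and on
  the set where one of \<open>u\<^sub>1, \<dots>, u\<^sub>m\<close> lies in that cell, the state \<open>x\<^sub>m\<close> does not depend on the initial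
  state. This set has volume at least \<open>1 - (1 - c)\<^sup>m\<close>. Combined with upper and lower sums of the
  Riemann integrable function \<open>f(x\<^sub>m(u\<^sub>0, \<dots>, u\<^sub>m))\<close>, this sandwiches \<open>f(x\<^sub>m)\<close>, for all initial states
  simultaneously, between two step functions of \<open>(u\<^sub>0, \<dots>, u\<^sub>m)\<close> with nearly equal integrals. By
  stationarity the integrals enclose \<open>\<integral>f d\<pi>\<close>; by equidistribution of the blocks
  \<open>(u\<^sub>i, \<dots>, u\<^sub>i\<^sub>+\<^sub>m)\<close> they are the limits of the averages that enclose those of \<open>f(x\<^sub>i\<^sub>+\<^sub>m)\<close>.

  A CUD sequence gives equidistribution of overlapping windows, whereas the blocks start at every
  \<open>d\<close>-th position only. The passage between the two is a second moment argument: over all positions,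
  a sum of \<open>L\<close> centred indicators of disjoint windows has mean square at most \<open>L + o(1)\<close>, so that the
  mean square over the positions in one residue class modulo \<open>d\<close> is at most \<open>d * (L + o(1))\<close>, which is
  negligible against \<open>L\<^sup>2\<close>.
\<close>

section \<open>Averages along arithmetic progressions\<close>

definition avg :: "(nat \<Rightarrow> real) \<Rightarrow> nat \<Rightarrow> real" where
  "avg h n = (\<Sum>i=1..n. h i) / real n"

lemma avg_sum: "avg (\<lambda>i. \<Sum>l\<in>A. h l i) n = (\<Sum>l\<in>A. avg (h l) n)"
  unfolding avg_def by (subst sum.swap) (simp add: sum_divide_distrib)

lemma avg_diff: "avg (\<lambda>i. g i - h i) n = avg g n - avg h n"
  unfolding avg_def by (simp add: sum_subtractf diff_divide_distrib)

lemma avg_add: "avg (\<lambda>i. g i + h i) n = avg g n + avg h n"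
  unfolding avg_def by (simp add: sum.distrib add_divide_distrib)

lemma avg_cmult: "avg (\<lambda>i. c * h i) n = c * avg h n"
  unfolding avg_def by (simp add: sum_distrib_left)

lemma avg_const: "n \<ge> 1 \<Longrightarrow> avg (\<lambda>_. c) n = c"
  unfolding avg_def by simp

lemma avg_mono: "(\<And>i. i \<ge> 1 \<Longrightarrow> g i \<le> h i) \<Longrightarrow> avg g n \<le> avg h n"
  unfolding avg_def by (intro divide_right_mono sum_mono) auto

lemma avg_cong: "(\<And>i. i \<ge> 1 \<Longrightarrow> g i = h i) \<Longrightarrow> avg g n = avg h n"
  unfolding avg_def by (intro arg_cong2[where f="(/)"] sum.cong) auto

lemma tendsto_avg_const: "avg (\<lambda>_. c) \<longlonglongrightarrow> c"
  by (rule tendsto_eventually) (auto simp: eventually_sequentially avg_const intro!: exI[of _ 1])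

text \<open>A shift by one telescopes to two boundary terms, each at most \<open>B\<close> in
  absolute value, so the averages differ by O(1/n); the general shift follows by induction.\<close>

lemma avg_shift_diff:
  assumes bd: "\<And>i. \<bar>h i\<bar> \<le> B"
  shows "(\<lambda>n. avg (\<lambda>i. h (i + s)) n - avg h n) \<longlonglongrightarrow> 0"
proof (induction s)
  case 0
  show ?case by simp
next
  case (Suc s)
  have tel: "avg (\<lambda>i. h (i + Suc s)) n - avg (\<lambda>i. h (i + s)) n = (h (Suc n + s) - h (1 + s)) / real n" for n
  proof -
    have "(\<Sum>i=1..n. h (i + Suc s) - h (i + s)) = h (Suc n + s) - h (1 + s)"
      by (induction n) auto
    then show ?thesis
      by (simp add: avg_def sum_subtractf flip: diff_divide_distrib)
  qed
  have "(\<lambda>n. (h (Suc n + s) - h (1 + s)) / real n) \<longlonglongrightarrow> 0"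
  proof (rule Lim_null_comparison)
    have "\<bar>h (Suc n + s) - h (1 + s)\<bar> \<le> 2 * B" for n
      using bd[of "Suc n + s"] bd[of "1 + s"] by linarith
    then show "\<forall>\<^sub>F n in sequentially. norm ((h (Suc n + s) - h (1 + s)) / real n) \<le> 2 * B / real n"
      by (auto intro!: always_eventually divide_right_mono)
    show "(\<lambda>n. 2 * B / real n) \<longlonglongrightarrow> 0"
      by (rule lim_const_over_n)
  qed
  then have "(\<lambda>n. avg (\<lambda>i. h (i + Suc s)) n - avg (\<lambda>i. h (i + s)) n) \<longlonglongrightarrow> 0"
    using tel by simp
  from tendsto_add[OF this Suc.IH] show ?case by simp
qed

lemma tendsto_avg_shift:
  assumes "\<And>i. \<bar>h i\<bar> \<le> B" and "avg h \<longlonglongrightarrow> c"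
  shows "avg (\<lambda>i. h (i + s)) \<longlonglongrightarrow> c"
  using tendsto_add[OF avg_shift_diff[where h=h and s=s, OF assms(1)] assms(2)] by simp

text \<open>Carries a bound over all positions to one residue class. Nonnegativity lets the other
  positions be discarded, at the price of a factor \<open>d\<close> after averaging.\<close>

lemma sum_progression_le:
  fixes Q :: "nat \<Rightarrow> real"
  assumes "d \<ge> 1" "\<And>j. Q j \<ge> 0"
  shows "(\<Sum>i=1..n. Q (d * (i - 1) + 1)) \<le> (\<Sum>j=1..d*n. Q j)"
proof -
  have inj: "inj_on (\<lambda>i. d * (i - 1) + 1) {1..n}"
    using assms(1) by (auto simp: inj_on_def)
  have sub: "(\<lambda>i. d * (i - 1) + 1) ` {1..n} \<subseteq> {1..d*n}"
  proof clarsimp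
    fix i assume "Suc 0 \<le> i" "i \<le> n"
    then obtain i' where i: "i = Suc i'" by (cases i) auto
    have "d * Suc i' \<le> d * n" using \<open>i \<le> n\<close> i by (intro mult_le_mono2) auto
    then show "Suc (d * (i - Suc 0)) \<le> d * n" using i assms(1) by simp
  qed
  have "(\<Sum>i=1..n. Q (d * (i - 1) + 1)) = sum Q ((\<lambda>i. d * (i - 1) + 1) ` {1..n})"
    by (subst sum.reindex[OF inj]) simp
  also have "\<dots> \<le> (\<Sum>j=1..d*n. Q j)"
    using sub assms(2) by (intro sum_mono2) auto
  finally show ?thesis .
qed

text \<open>Van der Corput's idea. The lags are multiples of \<open>d\<close>, so shifting
  \<open>H\<close> by them stays inside the progression and changes its average only by o(1). The
  average can thus be taken of a mean over \<open>L\<close> shifts, whose mean square over all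
  positions is of order 1/L because the correlations vanish.\<close>

lemma avg_progression_tendsto_0:
  fixes H :: "nat \<Rightarrow> real"
  assumes bd: "\<And>j. \<bar>H j\<bar> \<le> 1"
    and d: "d \<ge> 1"
    and cor: "\<And>l. l \<ge> 1 \<Longrightarrow> avg (\<lambda>j. H j * H (j + l * (d * q))) \<longlonglongrightarrow> 0"
  shows "avg (\<lambda>i. H (d * (i - 1) + 1)) \<longlonglongrightarrow> 0"
proof -
  define T where "T = d * q"
  define S where "S L j = (\<Sum>l<L. H (j + l * T))" for L j
  define h where "h i = H (d * (i - 1) + 1)" for i
  have prod_bd: "\<bar>H i * H j\<bar> \<le> 1" for i j
    using mult_mono[OF bd[of i] bd[of j]] by (simp add: abs_mult)
  \<comment> \<open>Only the difference of the two lags matters: shifting the correlation by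
    \<open>l * T\<close> does not change the limit of its average.\<close>
  have cross0: "avg (\<lambda>j. H (j + l * T) * H (j + l' * T)) \<longlonglongrightarrow> 0" if "l < l'" for l l'
  proof -
    have "avg (\<lambda>j. H j * H (j + (l' - l) * T)) \<longlonglongrightarrow> 0"
      using cor[of "l' - l"] that by (simp add: T_def)
    from tendsto_avg_shift[where h="\<lambda>j. H j * H (j + (l' - l) * T)", OF prod_bd this, of "l * T"]
    moreover have "j + l * T + (l' - l) * T = j + l' * T" for j
      using that by (metis add.assoc add_mult_distrib le_add_diff_inverse less_imp_le)
    ultimately show ?thesis by (simp only:)
  qed
  have cross: "avg (\<lambda>j. if l = l' then 0 else H (j + l * T) * H (j + l' * T)) \<longlonglongrightarrow> 0" for l l'
  proof (cases l l' rule: linorder_cases)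
    case less
    then show ?thesis using cross0[of l l'] by simp
  next
    case equal
    then show ?thesis using tendsto_avg_const[of 0] by simp
  next
    case greater
    then show ?thesis using cross0[of l' l] by (simp add: mult.commute)
  qed
  \<comment> \<open>The \<open>L\<close> diagonal terms contribute at most 1 each; the average of
    the off-diagonal terms tends to 0 and is eventually below 1.\<close>
  have square: "\<forall>\<^sub>F n in sequentially. avg (\<lambda>j. (S L j)\<^sup>2) n \<le> real L + 1" for L
  proof -
    define E where "E j = (\<Sum>l<L. \<Sum>l'<L. if l = l' then 0 else H (j + l * T) * H (j + l' * T))" for j
    have "avg E \<longlonglongrightarrow> (\<Sum>l<L. \<Sum>l'<L. 0)"
      unfolding E_def avg_sum[abs_def] by (intro tendsto_sum cross)
    then have "\<forall>\<^sub>F n in sequentially. avg E n < 1"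
      by (intro order_tendstoD(2)[where a=1]) auto
    moreover have "(S L j)\<^sup>2 \<le> E j + real L" for j
    proof -
      have "(S L j)\<^sup>2 = (\<Sum>l<L. \<Sum>l'<L. H (j + l * T) * H (j + l' * T))"
        by (simp add: S_def power2_eq_square sum_product)
      also have "\<dots> = (\<Sum>l<L. \<Sum>l'<L. (if l = l' then 0 else H (j + l * T) * H (j + l' * T))
                         + (if l = l' then H (j + l * T) * H (j + l' * T) else 0))"
        by (intro sum.cong) auto
      also have "\<dots> = E j + (\<Sum>l<L. H (j + l * T) * H (j + l * T))"
        by (simp add: sum.distrib E_def)
      also have "\<dots> \<le> E j + (\<Sum>l<L. 1)"
        using prod_bd by (intro add_left_mono sum_mono) (meson abs_le_D1)
      finally show ?thesis by simp
    qed
    then have "avg (\<lambda>j. (S L j)\<^sup>2) n \<le> avg E n + avg (\<lambda>_. real L) n" for n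
      unfolding avg_add[symmetric] by (rule avg_mono)
    moreover have "avg (\<lambda>_. real L) n \<le> real L" for n
      by (simp add: avg_def)
    ultimately show ?thesis
      by (auto elim!: eventually_mono) (smt (verit))
  qed
  show ?thesis
    unfolding h_def[symmetric]
  proof (rule LIMSEQ_I)
    fix r :: real assume r: "0 < r"
    define e where "e = r / 2"
    have e: "e > 0" using r by (simp add: e_def)
    \<comment> \<open>Chosen so that the error \<open>real d / e\<close> in the estimate below stays
      under \<open>e * L / 2\<close>.\<close>
    obtain L0 :: nat where L0: "real L0 > 2 * real d / e\<^sup>2"
      using reals_Archimedean2 by blast
    define L where "L = Suc L0"
    have L1: "real L \<ge> 1" and L2: "real L > 2 * real d / e\<^sup>2" using L0 by (auto simp: L_def)
    have "filterlim (\<lambda>n. d * n) sequentially sequentially"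
      using d by (intro filterlim_subseq) (auto simp: strict_mono_def)
    then have ev1: "\<forall>\<^sub>F n in sequentially. avg (\<lambda>j. (S L j)\<^sup>2) (d * n) \<le> real L + 1"
      using square[of L] by (rule eventually_compose_filterlim[rotated])
    \<comment> \<open>Moving \<open>q\<close> steps along the progression shifts \<open>H\<close> by
      \<open>T\<close>, so the average of \<open>S L\<close> along the progression is
      \<open>L\<close> times that of \<open>h\<close> up to o(1).\<close>
    have "(\<lambda>n. \<Sum>l<L. avg (\<lambda>i. h (i + l * q)) n - avg h n) \<longlonglongrightarrow> (\<Sum>l<L. 0)"
      using bd by (intro tendsto_sum avg_shift_diff[where B=1]) (auto simp: h_def)
    then have "(\<lambda>n. \<bar>\<Sum>l<L. avg (\<lambda>i. h (i + l * q)) n - avg h n\<bar>) \<longlonglongrightarrow> 0"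
      by (simp add: tendsto_rabs_zero)
    then have ev2: "\<forall>\<^sub>F n in sequentially. \<bar>\<Sum>l<L. avg (\<lambda>i. h (i + l * q)) n - avg h n\<bar> < e"
      using e by (rule order_tendstoD(2))
    have "\<forall>\<^sub>F n in sequentially. norm (avg h n - 0) < r"
      using ev1 ev2 eventually_gt_at_top[of 0]
    proof eventually_elim
      case (elim n)
      have hS: "(\<Sum>l<L. avg (\<lambda>i. h (i + l * q)) n) = avg (\<lambda>i. S L (d * (i - 1) + 1)) n"
        unfolding avg_sum[symmetric] S_def
      proof (intro avg_cong sum.cong refl)
        fix i l :: nat assume "i \<ge> 1"
        then obtain i' where "i = Suc i'" by (cases i) auto
        then show "h (i + l * q) = H (d * (i - 1) + 1 + l * T)"
          by (simp add: h_def T_def algebra_simps)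
      qed
      \<comment> \<open>AM-GM with weight \<open>e * L\<close> passes from squares to absolute
        values, taking the place of Cauchy-Schwarz.\<close>
      have am: "\<bar>s\<bar> \<le> e * L / 2 + s\<^sup>2 / (2 * e * L)" for s :: real
      proof -
        have "0 \<le> (\<bar>s\<bar> - e * L)\<^sup>2" by simp
        then have "2 * (e * L) * \<bar>s\<bar> \<le> s\<^sup>2 + (e * L)\<^sup>2"
          by (simp add: power2_diff mult_ac)
        then have "\<bar>s\<bar> \<le> (s\<^sup>2 + (e * L)\<^sup>2) / (2 * (e * L))"
          using e L1 by (simp add: pos_le_divide_eq mult.commute)
        also have "\<dots> = e * L / 2 + s\<^sup>2 / (2 * e * L)"
          using e L1 by (simp add: field_simps power2_eq_square)
        finally show ?thesis .
      qed
      have "(\<Sum>i=1..n. (S L (d * (i - 1) + 1))\<^sup>2) \<le> (\<Sum>j=1..d*n. (S L j)\<^sup>2)"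
        by (rule sum_progression_le) (use d in auto)
      also have "\<dots> \<le> (real L + 1) * (real d * real n)"
        using elim(1,3) d by (simp add: avg_def pos_divide_le_eq)
      finally have sq: "avg (\<lambda>i. (S L (d * (i - 1) + 1))\<^sup>2) n \<le> (real L + 1) * real d"
        using elim(3) by (simp add: avg_def pos_divide_le_eq mult_ac)
      have "avg (\<lambda>i. \<bar>S L (d * (i - 1) + 1)\<bar>) n
          \<le> avg (\<lambda>i. e * L / 2 + (1 / (2 * e * L)) * (S L (d * (i - 1) + 1))\<^sup>2) n"
        using am by (intro avg_mono) simp
      also have "\<dots> = e * L / 2 + (1 / (2 * e * L)) * avg (\<lambda>i. (S L (d * (i - 1) + 1))\<^sup>2) n"
        using elim(3) by (simp only: avg_add avg_cmult avg_const[of n "e * L / 2"])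
      also have "\<dots> \<le> e * L / 2 + (1 / (2 * e * L)) * ((real L + 1) * real d)"
        using sq e L1 by (intro add_left_mono mult_left_mono) auto
      also have "\<dots> \<le> e * L / 2 + (1 / (2 * e * L)) * ((2 * real L) * real d)"
        using e L1 by (intro add_left_mono mult_left_mono mult_right_mono) auto
      also have "\<dots> = e * L / 2 + real d / e"
        using e L1 by simp
      also have "\<dots> < e * L / 2 + e * L / 2"
      proof -
        have "2 * real d < real L * e\<^sup>2" using L2 e by (simp add: pos_divide_less_eq)
        then show ?thesis using e by (simp add: field_simps power2_eq_square)
      qed
      finally have A: "avg (\<lambda>i. \<bar>S L (d * (i - 1) + 1)\<bar>) n < e * L" by simp
      have "\<bar>avg (\<lambda>i. S L (d * (i - 1) + 1)) n\<bar> \<le> avg (\<lambda>i. \<bar>S L (d * (i - 1) + 1)\<bar>) n"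
        unfolding avg_def by (simp add: divide_right_mono sum_abs)
      with A have A': "\<bar>avg (\<lambda>i. S L (d * (i - 1) + 1)) n\<bar> < e * L" by simp
      have "real L * \<bar>avg h n\<bar> = \<bar>real L * avg h n\<bar>" by (simp add: abs_mult)
      also have "\<dots> = \<bar>avg (\<lambda>i. S L (d * (i - 1) + 1)) n - (\<Sum>l<L. avg (\<lambda>i. h (i + l * q)) n - avg h n)\<bar>"
        using hS by (simp add: sum_subtractf)
      also have "\<dots> < e * L + e" using A' elim(2) by linarith
      also have "\<dots> \<le> e * L + e * L" using e L1 by simp
      finally have "real L * \<bar>avg h n\<bar> < real L * (2 * e)" by (simp add: mult_ac)
      then have "\<bar>avg h n\<bar> < 2 * e" using L1 by simp
      then show ?case by (simp add: e_def)
    qed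
    then show "\<exists>no. \<forall>n\<ge>no. norm (avg h n - 0) < r"
      by (simp add: eventually_sequentially)
  qed
qed

section \<open>Equidistribution of the blocks of a CUD sequence\<close>

definition window :: "(nat \<Rightarrow> real) \<Rightarrow> nat \<Rightarrow> nat \<Rightarrow> point" where
  "window v k i = (\<lambda>j\<in>{..<k}. v (i + j))"

lemma cud_range: "cud v \<Longrightarrow> i \<ge> 1 \<Longrightarrow> v i \<in> {0..1}"
  unfolding cud_def by blast

lemma window_in_cube: "cud v \<Longrightarrow> i \<ge> 1 \<Longrightarrow> window v k i \<in> cube k"
  unfolding window_def cube_def by (intro restrict_PiE_iff[THEN iffD2] ballI cud_range) auto

lemma prod_cube_bounds:
  assumes "a \<in> cube k"
  shows "0 \<le> (\<Prod>j<k. a j)" "(\<Prod>j<k. a j) \<le> 1"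
proof -
  have a: "0 \<le> a j \<and> a j \<le> 1" if "j \<in> {..<k}" for j
    using PiE_mem[OF assms[unfolded cube_def] that] by simp
  show "0 \<le> (\<Prod>j<k. a j)"
    by (rule prod_nonneg) (use a in blast)
  show "(\<Prod>j<k. a j) \<le> 1"
    by (rule prod_le_1) (use a in blast)
qed

lemma cud_anchored_box:
  assumes "cud v" "k \<ge> 1" "a \<in> cube k"
  shows "avg (\<lambda>i. indicator (anchored_box k a) (window v k i)) \<longlonglongrightarrow> (\<Prod>j<k. a j)"
proof -
  define D where "D n a = \<bar>avg (\<lambda>i. indicator (anchored_box k a) (window v k i)) n - (\<Prod>j<k. a j)\<bar>" for n a
  \<comment> \<open>The supremum bounds the single boxes only if it ranges over a bounded set. For
    \<open>n = 0\<close> the average is 0, as division by 0 yields 0.\<close>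
  have bdd: "bdd_above (D n ` cube k)" for n
  proof (rule bdd_aboveI2)
    fix a assume a: "a \<in> cube k"
    have "avg (\<lambda>_. 0) n \<le> avg (\<lambda>i. indicator (anchored_box k a) (window v k i)) n"
      by (rule avg_mono) simp
    moreover have "avg (\<lambda>i. indicator (anchored_box k a) (window v k i)) n \<le> avg (\<lambda>_. 1) n"
      by (rule avg_mono) (simp add: indicator_def)
    ultimately have "0 \<le> avg (\<lambda>i. indicator (anchored_box k a) (window v k i)) n"
      "avg (\<lambda>i. indicator (anchored_box k a) (window v k i)) n \<le> 1"
      by (auto simp: avg_def split: if_splits)
    then show "D n a \<le> 1"
      using prod_cube_bounds[OF a] by (simp add: D_def)
  qed
  have "star_discrepancy k n (window v k) = (SUP a\<in>cube k. D n a)" for n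
    by (simp add: star_discrepancy_def D_def avg_def)
  moreover have "(\<lambda>n. star_discrepancy k n (window v k)) \<longlonglongrightarrow> 0"
    using assms(1,2) by (simp add: cud_def window_def[abs_def])
  ultimately have "(\<lambda>n. SUP a\<in>cube k. D n a) \<longlonglongrightarrow> 0" by simp
  then have "(\<lambda>n. avg (\<lambda>i. indicator (anchored_box k a) (window v k i)) n - (\<Prod>j<k. a j)) \<longlonglongrightarrow> 0"
    by (rule Lim_null_comparison[rotated])
       (use cSUP_upper[OF assms(3) bdd] in \<open>auto simp: D_def\<close>)
  then show ?thesis by (simp add: LIM_zero_iff)
qed

text \<open>
  A threshold \<open>a j > 1\<close> imposes no condition on a point of the cube. Anchored boxes cannot express
  this, because \<open>a j = 1\<close> excludes the value 1; the two indicators differ only where some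
  coordinate equals 1, which has frequency 0.
\<close>

definition below :: "nat \<Rightarrow> (nat \<Rightarrow> real) \<Rightarrow> point \<Rightarrow> real" where
  "below k a w = of_bool (\<forall>j<k. w j < a j)"

lemma below_window: "below k a (window v k i) = of_bool (\<forall>j<k. v (i + j) < a j)"
  by (auto simp: below_def window_def)

lemma cud_below:
  assumes v: "cud v" and k: "k \<ge> 1" and a: "\<And>j. j < k \<Longrightarrow> a j \<ge> 0"
  shows "avg (\<lambda>i. below k a (window v k i)) \<longlonglongrightarrow> (\<Prod>j<k. min 1 (a j))"
proof -
  define a' where "a' = (\<lambda>j\<in>{..<k}. min 1 (a j))"
  define one :: point where "one = (\<lambda>j\<in>{..<k}. 1)"
  let ?I = "\<lambda>a. avg (\<lambda>i. indicator (anchored_box k a) (window v k i))"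
  have cube: "a' \<in> cube k" "one \<in> cube k"
    using a by (auto simp: a'_def one_def cube_def)
  have lim: "?I a' \<longlonglongrightarrow> (\<Prod>j<k. min 1 (a j))" "?I one \<longlonglongrightarrow> 1"
    using cud_anchored_box[OF v k cube(1)] cud_anchored_box[OF v k cube(2)]
    by (simp_all add: a'_def one_def)
  have low: "indicator (anchored_box k a') (window v k i) \<le> below k a (window v k i)" for i
    by (auto simp: indicator_def anchored_box_def a'_def below_def PiE_iff)
  have upp: "below k a (window v k i) \<le> indicator (anchored_box k a') (window v k i)
      + (1 - indicator (anchored_box k one) (window v k i))" if "i \<ge> 1" for i
    using window_in_cube[OF v that, of k]
    by (auto simp: indicator_def anchored_box_def a'_def one_def below_def cube_def PiE_iff)
  show ?thesis
  proof (rule real_tendsto_sandwich)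
    show "\<forall>\<^sub>F n in sequentially. ?I a' n \<le> avg (\<lambda>i. below k a (window v k i)) n"
      using low by (intro always_eventually allI avg_mono)
    show "\<forall>\<^sub>F n in sequentially. avg (\<lambda>i. below k a (window v k i)) n
        \<le> ?I a' n + (avg (\<lambda>_. 1) n - ?I one n)"
      unfolding avg_diff[symmetric] avg_add[symmetric]
      using upp by (intro always_eventually allI avg_mono)
    show "(\<lambda>n. ?I a' n + (avg (\<lambda>_. 1) n - ?I one n)) \<longlonglongrightarrow> (\<Prod>j<k. min 1 (a j))"
      by (rule tendsto_eq_intros lim tendsto_avg_const refl)+ simp
  qed (rule lim)
qed

text \<open>For lags at least \<open>k\<close> the product of two box indicators is again a box
  indicator, of a longer window with no condition in the gap, so its limit factorises. The
  correlations of the centred indicators therefore vanish.\<close>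

lemma cud_below_progression:
  assumes v: "cud v" and k: "k \<ge> 1" and d: "d \<ge> 1" and a: "\<And>j. j < k \<Longrightarrow> a j \<ge> 0"
  shows "avg (\<lambda>i. below k a (window v k (d * (i - 1) + 1))) \<longlonglongrightarrow> (\<Prod>j<k. min 1 (a j))"
proof -
  define \<mu> where "\<mu> = (\<Prod>j<k. min 1 (a j))"
  define G where "G i = below k a (window v k i)" for i
  define H where "H i = G i - \<mu>" for i
  have "0 \<le> \<mu>"
    unfolding \<mu>_def by (rule prod_nonneg) (simp add: a)
  moreover have "\<mu> \<le> 1"
    unfolding \<mu>_def by (rule prod_le_1) (simp add: a)
  ultimately have \<mu>: "0 \<le> \<mu>" "\<mu> \<le> 1" .
  have G01: "0 \<le> G i" "G i \<le> 1" for i by (auto simp: G_def below_def)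
  have Gb: "\<bar>G i\<bar> \<le> 1" for i using G01[of i] by simp
  have Gavg: "avg G \<longlonglongrightarrow> \<mu>"
    unfolding G_def[abs_def] \<mu>_def by (rule cud_below[OF v k a])
  have GG: "avg (\<lambda>j. G j * G (j + t)) \<longlonglongrightarrow> \<mu> * \<mu>" if t: "t \<ge> k" for t
  proof -
    \<comment> \<open>The value 2 leaves the gap between the two windows unconstrained, since the
      sequence never exceeds 1.\<close>
    define a2 where "a2 j = (if j < k then a j else if j < t then 2 else a (j - t))" for j
    have "(\<forall>j<k+t. v (i + j) < a2 j) \<longleftrightarrow> (\<forall>j<k. v (i + j) < a j) \<and> (\<forall>j<k. v (i + t + j) < a j)"
      if i: "i \<ge> 1" for i
    proof safe
      fix j assume *: "\<forall>j<k+t. v (i + j) < a2 j" and j: "j < k"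
      show "v (i + j) < a j" using *[rule_format, of j] j by (simp add: a2_def)
      show "v (i + t + j) < a j" using *[rule_format, of "t + j"] j t by (simp add: a2_def add.assoc)
    next
      fix j assume *: "\<forall>j<k. v (i + j) < a j" "\<forall>j<k. v (i + t + j) < a j" and j: "j < k + t"
      have "v (i + j) \<le> 1" using cud_range[OF v, of "i + j"] i by simp
      moreover have "v (i + j) < a (j - t)" if "t \<le> j"
        using *(2)[rule_format, of "j - t"] that j by auto
      ultimately show "v (i + j) < a2 j" using *(1) t by (auto simp: a2_def)
    qed
    then have eq: "G i * G (i + t) = below (k + t) a2 (window v (k + t) i)" if "i \<ge> 1" for i
      using that unfolding G_def below_window by simp
    have "(\<Prod>j<k+t. min 1 (a2 j)) = (\<Prod>j\<in>{..<t}. min 1 (a2 j)) * (\<Prod>j\<in>{t..<t+k}. min 1 (a2 j))"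
      by (subst prod.union_disjoint[symmetric]) (auto intro!: prod.cong)
    also have "(\<Prod>j\<in>{..<t}. min 1 (a2 j)) = (\<Prod>j<k. min 1 (a2 j))"
      using t by (intro prod.mono_neutral_right) (auto simp: a2_def)
    also have "\<dots> = \<mu>" by (simp add: a2_def \<mu>_def)
    also have "(\<Prod>j\<in>{t..<t+k}. min 1 (a2 j)) = (\<Prod>j<k. min 1 (a2 (j + t)))"
      using prod.shift_bounds_nat_ivl[of "\<lambda>j. min 1 (a2 j)" 0 t k]
      by (simp add: atLeast0LessThan add.commute)
    also have "\<dots> = \<mu>" using t by (simp add: a2_def \<mu>_def)
    finally have "(\<Prod>j<k+t. min 1 (a2 j)) = \<mu> * \<mu>" .
    moreover have "avg (\<lambda>i. below (k + t) a2 (window v (k + t) i)) \<longlonglongrightarrow> (\<Prod>j<k+t. min 1 (a2 j))"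
      using a k by (intro cud_below[OF v]) (auto simp: a2_def)
    moreover have "avg (\<lambda>i. G i * G (i + t)) = avg (\<lambda>i. below (k + t) a2 (window v (k + t) i))"
      by (intro ext avg_cong eq)
    ultimately show ?thesis by simp
  qed
  have "avg (\<lambda>i. H (d * (i - 1) + 1)) \<longlonglongrightarrow> 0"
  proof (rule avg_progression_tendsto_0[OF _ d])
    show "\<bar>H j\<bar> \<le> 1" for j using G01[of j] \<mu> by (auto simp: H_def)
    fix l :: nat assume "l \<ge> 1"
    then have t: "l * (d * k) \<ge> k" using d by simp
    define t where "t = l * (d * k)"
    \<comment> \<open>Expansion of the covariance. The constant is kept as an average so that the
      identity below also holds at \<open>n = 0\<close>.\<close>
    have "(\<lambda>n. avg (\<lambda>j. G j * G (j + t)) n - \<mu> * avg G n - \<mu> * avg (\<lambda>j. G (j + t)) n + avg (\<lambda>_. \<mu> * \<mu>) n)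
        \<longlonglongrightarrow> \<mu> * \<mu> - \<mu> * \<mu> - \<mu> * \<mu> + \<mu> * \<mu>"
      using t unfolding t_def[symmetric]
      by (intro tendsto_intros GG Gavg tendsto_avg_shift[OF Gb Gavg] tendsto_avg_const)
    moreover have "avg (\<lambda>j. H j * H (j + t))
        = (\<lambda>n. avg (\<lambda>j. G j * G (j + t)) n - \<mu> * avg G n - \<mu> * avg (\<lambda>j. G (j + t)) n + avg (\<lambda>_. \<mu> * \<mu>) n)"
      unfolding avg_cmult[symmetric] avg_diff[symmetric] avg_add[symmetric]
      by (intro ext avg_cong) (simp add: H_def algebra_simps)
    ultimately show "avg (\<lambda>j. H j * H (j + l * (d * k))) \<longlonglongrightarrow> 0"
      unfolding t_def[symmetric] by simp
  qed
  from tendsto_add[OF this tendsto_avg_const[of \<mu>]]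
  show ?thesis
    unfolding avg_add[symmetric] by (simp add: H_def G_def \<mu>_def)
qed

section \<open>Step functions on the cube\<close>

definition unit_measure :: "real measure" where
  "unit_measure = restrict_space lborel {0..1}"

lemma uniform_cube_eq: "uniform_cube N = (\<Pi>\<^sub>M i\<in>{..<N}. unit_measure)"
  by (simp add: uniform_cube_def unit_measure_def)

lemma space_unit_measure: "space unit_measure = {0..1}"
  by (simp add: unit_measure_def space_restrict_space)

lemma borel_measurable_unit_measure: "f \<in> borel_measurable borel \<Longrightarrow> f \<in> borel_measurable unit_measure"
  unfolding unit_measure_def by (rule measurable_restrict_space1) simp

lemma prob_space_unit_measure: "prob_space unit_measure"
  by (rule prob_spaceI) (simp add: unit_measure_def space_restrict_space emeasure_restrict_space)

lemma space_uniform_cube: "space (uniform_cube N) = cube N"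
  by (simp add: uniform_cube_eq space_PiM space_unit_measure cube_def)

lemma prob_space_uniform_cube: "prob_space (uniform_cube N)"
  unfolding uniform_cube_eq by (intro prob_space_PiM prob_space_unit_measure)

lemma product_sigma_finite_unit: "product_sigma_finite (\<lambda>_::nat. unit_measure)"
  unfolding product_sigma_finite_def by (simp add: prob_space_imp_sigma_finite prob_space_unit_measure)

lemma integral_unit_below:
  assumes "a \<ge> 0"
  shows "integrable unit_measure (\<lambda>t. of_bool (t < a) :: real)"
    and "(\<integral>t. of_bool (t < a) \<partial>unit_measure) = min 1 a"
proof -
  interpret prob_space unit_measure by (rule prob_space_unit_measure)
  have eq: "(\<lambda>t. of_bool (t < a) :: real) = indicator {..<a}"
    by (auto simp: indicator_def)
  show "integrable unit_measure (\<lambda>t. of_bool (t < a) :: real)"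
    unfolding eq by (intro integrable_const_bound[where B=1] borel_measurable_unit_measure AE_I2)
      (simp_all add: indicator_def)
  have "(\<integral>t. of_bool (t < a) \<partial>unit_measure) = measure unit_measure ({..<a} \<inter> {0..1})"
    by (simp add: eq space_unit_measure)
  also have "\<dots> = measure lborel ({..<a} \<inter> {0..1})"
    unfolding unit_measure_def by (rule measure_restrict_space) auto
  also have "{..<a} \<inter> {0..1} = (if a \<le> 1 then {0..<a} else {0..1})"
    using assms by auto
  also have "measure lborel \<dots> = min 1 a"
    using assms by auto
  finally show "(\<integral>t. of_bool (t < a) \<partial>unit_measure) = min 1 a" .
qed

lemma integral_uniform_cube_prod:
  fixes f :: "nat \<Rightarrow> real \<Rightarrow> real"
  assumes "\<And>j. j < N \<Longrightarrow> integrable unit_measure (f j)"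
  shows "(\<integral>w. (\<Prod>j<N. f j (w j)) \<partial>uniform_cube N) = (\<Prod>j<N. \<integral>t. f j t \<partial>unit_measure)"
    and "integrable (uniform_cube N) (\<lambda>w. \<Prod>j<N. f j (w j))"
  using product_sigma_finite.product_integral_prod[OF product_sigma_finite_unit, of "{..<N}" f]
    product_sigma_finite.product_integrable_prod[OF product_sigma_finite_unit, of "{..<N}" f] assms
  by (auto simp: uniform_cube_eq)

lemma prod_of_bool: "(\<Prod>j<N. of_bool (P j) :: real) = of_bool (\<forall>j<N. P j)" for N :: nat
  by (induction N) (auto simp: less_Suc_eq)

lemma integral_below:
  assumes "\<And>j. j < N \<Longrightarrow> a j \<ge> 0"
  shows "integrable (uniform_cube N) (below N a)"
    and "(\<integral>w. below N a w \<partial>uniform_cube N) = (\<Prod>j<N. min 1 (a j))"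
proof -
  have eq: "below N a = (\<lambda>w. \<Prod>j<N. of_bool (w j < a j))"
    by (auto simp: below_def prod_of_bool)
  show "integrable (uniform_cube N) (below N a)"
    unfolding eq using assms by (intro integral_uniform_cube_prod integral_unit_below) auto
  have "(\<integral>w. below N a w \<partial>uniform_cube N) = (\<Prod>j<N. \<integral>t. of_bool (t < a j) \<partial>unit_measure)"
    unfolding eq using assms by (intro integral_uniform_cube_prod integral_unit_below) auto
  also have "\<dots> = (\<Prod>j<N. min 1 (a j))"
    using assms by (intro prod.cong integral_unit_below) auto
  finally show "(\<integral>w. below N a w \<partial>uniform_cube N) = (\<Prod>j<N. min 1 (a j))" .
qed

text \<open>The algebra generated by indicators of coordinate half-lines. As an inductive class it
  allows cells to be assembled by closure rules and properties to be proved on generators. The form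
  \<open>w j < a\<close> matches \<open>below\<close>.\<close>

inductive step_fun :: "nat \<Rightarrow> (point \<Rightarrow> real) \<Rightarrow> bool" for N where
  const: "step_fun N (\<lambda>_. c)"
| atom: "j < N \<Longrightarrow> a \<ge> 0 \<Longrightarrow> step_fun N (\<lambda>w. of_bool (w j < a))"
| add: "step_fun N g \<Longrightarrow> step_fun N h \<Longrightarrow> step_fun N (\<lambda>w. g w + h w)"
| mult: "step_fun N g \<Longrightarrow> step_fun N h \<Longrightarrow> step_fun N (\<lambda>w. g w * h w)"

lemma step_fun_cmult: "step_fun N h \<Longrightarrow> step_fun N (\<lambda>w. c * h w)"
  by (rule step_fun.mult[OF step_fun.const])

lemma step_fun_diff: "step_fun N g \<Longrightarrow> step_fun N h \<Longrightarrow> step_fun N (\<lambda>w. g w - h w)"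
  using step_fun.add[OF _ step_fun_cmult[where c="-1"]] by fastforce

lemma step_fun_sum: "finite A \<Longrightarrow> (\<And>x. x \<in> A \<Longrightarrow> step_fun N (h x)) \<Longrightarrow> step_fun N (\<lambda>w. \<Sum>x\<in>A. h x w)"
  by (induction A rule: finite_induct) (auto intro: step_fun.intros)

lemma step_fun_prod: "finite A \<Longrightarrow> (\<And>x. x \<in> A \<Longrightarrow> step_fun N (h x)) \<Longrightarrow> step_fun N (\<lambda>w. \<Prod>x\<in>A. h x w)"
  by (induction A rule: finite_induct) (auto intro: step_fun.intros)

lemma step_fun_block:
  assumes "step_fun d h" "d * i + d \<le> N"
  shows "step_fun N (\<lambda>w. h (block d w i))"
  using assms(1)
proof induction
  case (atom j a)
  then show ?case using step_fun.atom[of "d * i + j" N a] assms(2) by (simp add: block_def)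
qed (auto intro: step_fun.intros)

text \<open>Integrability belongs to the notion because the integral of a non-integrable function is
  0 by default, so that additivity of the integral could fail without it.\<close>

definition equidistributed :: "nat \<Rightarrow> (nat \<Rightarrow> point) \<Rightarrow> (point \<Rightarrow> real) \<Rightarrow> bool" where
  "equidistributed N y h \<longleftrightarrow> integrable (uniform_cube N) h \<and>
     avg (\<lambda>i. h (y i)) \<longlonglongrightarrow> (\<integral>w. h w \<partial>uniform_cube N)"

lemma equidistributed_cong:
  assumes "equidistributed N y g" "\<And>w. w \<in> cube N \<Longrightarrow> g w = h w" "\<And>i. i \<ge> 1 \<Longrightarrow> y i \<in> cube N"
  shows "equidistributed N y h"
proof -
  have "avg (\<lambda>i. g (y i)) = avg (\<lambda>i. h (y i))"
    using assms(2,3) by (intro ext avg_cong) auto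
  moreover have "integrable (uniform_cube N) g = integrable (uniform_cube N) h"
    using assms(2) by (intro Bochner_Integration.integrable_cong) (auto simp: space_uniform_cube)
  moreover have "(\<integral>w. g w \<partial>uniform_cube N) = (\<integral>w. h w \<partial>uniform_cube N)"
    using assms(2) by (intro Bochner_Integration.integral_cong) (auto simp: space_uniform_cube)
  ultimately show ?thesis using assms(1) by (simp add: equidistributed_def)
qed

lemma equidistributed_add:
  "equidistributed N y g \<Longrightarrow> equidistributed N y h \<Longrightarrow> equidistributed N y (\<lambda>w. g w + h w)"
  unfolding equidistributed_def avg_add[abs_def] by (auto intro: tendsto_add)

lemma equidistributed_cmult: "equidistributed N y h \<Longrightarrow> equidistributed N y (\<lambda>w. c * h w)"
  unfolding equidistributed_def avg_cmult[abs_def] by (auto intro: tendsto_mult_left)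

text \<open>
  Equidistribution is not preserved by products. The induction therefore shows that multiplication by
  \<open>h\<close> preserves the functions that remain equidistributed after multiplication by any box indicator.
\<close>

lemma step_fun_equidistributed:
  assumes y: "\<And>i. i \<ge> 1 \<Longrightarrow> y i \<in> cube N"
    and base: "\<And>a. (\<And>j. j < N \<Longrightarrow> a j \<ge> 0) \<Longrightarrow> equidistributed N y (below N a)"
    and h: "step_fun N h"
  shows "equidistributed N y h"
proof -
  define Q where "Q g \<longleftrightarrow> (\<forall>a. (\<forall>j<N. a j \<ge> 0) \<longrightarrow> equidistributed N y (\<lambda>w. g w * below N a w))" for g
  from h have P: "\<forall>g. Q g \<longrightarrow> Q (\<lambda>w. h w * g w)"
  proof induction
    case (const c)
    show ?case
      using equidistributed_cmult[where N=N and y=y and c=c] by (auto simp: Q_def mult.assoc)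
  next
    case (atom j t)
    show ?case
    proof safe
      fix g assume g: "Q g"
      show "Q (\<lambda>w. of_bool (w j < t) * g w)"
        unfolding Q_def
      proof safe
        fix a :: "nat \<Rightarrow> real" assume a: "\<forall>j<N. 0 \<le> a j"
        \<comment> \<open>A further half-line condition only lowers one threshold of the box, so
          \<open>g\<close> is merely multiplied by another box indicator.\<close>
        have "of_bool (w j < t) * g w * below N a w = g w * below N (a(j := min t (a j))) w" for w
          using atom by (auto simp: below_def)
        moreover have "\<forall>i<N. 0 \<le> (a(j := min t (a j))) i" using a atom by auto
        ultimately show "equidistributed N y (\<lambda>w. of_bool (w j < t) * g w * below N a w)"
          using g by (simp only: Q_def)
      qed
    qed
  next
    case (add h1 h2)
    then show ?case
      using equidistributed_add[where N=N and y=y] by (auto simp: Q_def distrib_right)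
  next
    case (mult h1 h2)
    then show ?case by (simp add: mult.assoc)
  qed
  have "Q (\<lambda>_. 1)"
    using base by (simp add: Q_def)
  with P have "Q (\<lambda>w. h w * 1)" by blast
  then have "equidistributed N y (\<lambda>w. h w * 1 * below N (\<lambda>_. 2) w)"
    by (simp add: Q_def)
  then show ?thesis
    by (rule equidistributed_cong[OF _ _ y]) (auto simp: below_def cube_def dest!: PiE_mem)
qed

text \<open>Step functions are measurable and bounded, by induction on their construction, and the
  measure is finite.\<close>

lemma step_fun_integrable:
  assumes "step_fun N h"
  shows "integrable (uniform_cube N) h"
proof -
  interpret prob_space "uniform_cube N" by (rule prob_space_uniform_cube)
  have "h \<in> borel_measurable (uniform_cube N)"
    using assms
  proof induction
    case (atom j a)
    have "(\<lambda>w. w j) \<in> uniform_cube N \<rightarrow>\<^sub>M unit_measure"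
      unfolding uniform_cube_eq using atom by (intro measurable_component_singleton) auto
    moreover have "(\<lambda>t. of_bool (t < a) :: real) \<in> borel_measurable unit_measure"
      by (intro borel_measurable_unit_measure) measurable
    ultimately show ?case by (rule measurable_compose)
  qed auto
  moreover have "\<exists>B. \<forall>w. \<bar>h w\<bar> \<le> B"
    using assms
  proof induction
    case (add g h)
    then show ?case by (meson abs_triangle_ineq add_mono order_trans)
  next
    case (mult g h)
    then obtain A B where "\<forall>w. \<bar>g w\<bar> \<le> A" "\<forall>w. \<bar>h w\<bar> \<le> B" by blast
    then have "\<bar>g w * h w\<bar> \<le> A * B" for w
      unfolding abs_mult by (intro mult_mono) (auto intro: order_trans[OF abs_ge_zero])
    then show ?case by blast
  qed (auto intro: exI[of _ 1])
  then obtain B where "\<forall>w. \<bar>h w\<bar> \<le> B" ..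
  ultimately show ?thesis
    by (intro integrable_const_bound[where B=B] AE_I2) auto
qed

lemma cud_equidistributed:
  assumes "cud v" "N \<ge> 1" "d \<ge> 1" "step_fun N h"
  shows "equidistributed N (\<lambda>i. window v N (d * (i - 1) + 1)) h"
proof (rule step_fun_equidistributed[OF _ _ assms(4)])
  show "window v N (d * (i - 1) + 1) \<in> cube N" for i
    by (rule window_in_cube[OF assms(1)]) simp
  show "equidistributed N (\<lambda>i. window v N (d * (i - 1) + 1)) (below N a)"
    if a: "\<And>j. j < N \<Longrightarrow> 0 \<le> a j" for a
  proof -
    have "integrable (uniform_cube N) (below N a)"
      "(\<integral>w. below N a w \<partial>uniform_cube N) = (\<Prod>j<N. min 1 (a j))"
      by (rule integral_below, erule a)+
    moreover have "avg (\<lambda>i. below N a (window v N (d * (i - 1) + 1))) \<longlonglongrightarrow> (\<Prod>j<N. min 1 (a j))"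
      by (rule cud_below_progression[OF assms(1-3)]) (rule a)
    ultimately show ?thesis by (simp add: equidistributed_def)
  qed
qed

section \<open>Riemann integrable functions and grid cells\<close>

text \<open>
  The last threshold is 2 rather than 1, so that the half-open cells partition the closed cube.
\<close>

definition threshold :: "nat \<Rightarrow> nat \<Rightarrow> real" where
  "threshold k l = (if l < k then real l / real k else 2)"

text \<open>For \<open>l < k\<close> and on \<open>{0..1}\<close> this is the indicator of the
  \<open>l\<close>-th grid interval; a difference of two half-lines keeps it a step
  function.\<close>

definition bump :: "nat \<Rightarrow> nat \<Rightarrow> real \<Rightarrow> real" where
  "bump k l t = of_bool (t < threshold k (Suc l)) - of_bool (t < threshold k l)"

text \<open>The minimum with \<open>k - 1\<close> puts the endpoint 1 into the last cell.\<close>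

definition cell_index :: "nat \<Rightarrow> real \<Rightarrow> nat" where
  "cell_index k t = min (k - 1) (nat \<lfloor>real k * t\<rfloor>)"

definition cell_fun :: "nat \<Rightarrow> nat \<Rightarrow> (nat \<Rightarrow> nat) \<Rightarrow> point \<Rightarrow> real" where
  "cell_fun N k \<kappa> w = (\<Prod>c<N. bump k (\<kappa> c) (w c))"

abbreviation uniform_cell :: "nat \<Rightarrow> nat \<Rightarrow> (nat \<Rightarrow> nat) \<Rightarrow> point set" where
  "uniform_cell N k \<equiv> cell N (\<lambda>_ l. real l / real k)"

lemma threshold_nonneg: "0 \<le> threshold k l"
  by (simp add: threshold_def)

lemma cell_index_less: "k \<ge> 1 \<Longrightarrow> cell_index k t < k"
  by (simp add: cell_index_def min_less_iff_disj)

text \<open>Comparisons of reals become comparisons of indices, after which a bump is seen to single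
  out one index. For \<open>l \<ge> k\<close> both sides are true: \<open>t\<close> is below the
  threshold 2 and every index is below \<open>k\<close>.\<close>

lemma less_threshold_iff:
  assumes "k \<ge> 1" "0 \<le> t" "t \<le> 1"
  shows "t < threshold k l \<longleftrightarrow> cell_index k t < l"
proof (cases "l < k")
  case True
  have "t < real l / real k \<longleftrightarrow> real k * t < real l"
    using assms by (simp add: pos_less_divide_eq mult.commute)
  also have "\<dots> \<longleftrightarrow> nat \<lfloor>real k * t\<rfloor> < l"
    using assms by (metis floor_less_iff nat_less_iff mult_nonneg_nonneg of_int_of_nat_eq of_nat_0_le_iff zero_le_floor)
  finally show ?thesis using True by (auto simp: threshold_def cell_index_def min_less_iff_disj)
next
  case False
  then show ?thesis
    using assms cell_index_less[of k t] by (simp add: threshold_def)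
qed

lemma bump_eq:
  assumes "k \<ge> 1" "0 \<le> t" "t \<le> 1"
  shows "bump k l t = of_bool (l = cell_index k t)"
  unfolding bump_def less_threshold_iff[OF assms] by auto

lemma integral_bump:
  assumes "l < k"
  shows "integrable unit_measure (bump k l)" "(\<integral>t. bump k l t \<partial>unit_measure) = 1 / real k"
proof -
  show "integrable unit_measure (bump k l)"
    unfolding bump_def
    by (intro Bochner_Integration.integrable_diff integral_unit_below threshold_nonneg)
  \<comment> \<open>The integral sees the last threshold 2 only as 1, so the last interval has
    length \<open>1 / real k\<close> like the others.\<close>
  have "(\<integral>t. bump k l t \<partial>unit_measure) = min 1 (threshold k (Suc l)) - min 1 (threshold k l)"
    unfolding bump_def
    by (simp only: Bochner_Integration.integral_diff integral_unit_below threshold_nonneg)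
  also have "\<dots> = 1 / real k"
  proof (cases "Suc l = k")
    case True
    then have "threshold k l = 1 - 1 / real k" "threshold k (Suc l) = 2"
      by (auto simp: threshold_def field_simps)
    then show ?thesis using True by simp
  next
    case False
    then have "threshold k l = real l / real k" "threshold k (Suc l) = real (Suc l) / real k"
      using assms by (auto simp: threshold_def)
    moreover have "real l / real k \<le> 1" "real (Suc l) / real k \<le> 1"
      using assms by (auto simp: divide_le_eq_1)
    ultimately show ?thesis by (simp add: diff_divide_distrib[symmetric])
  qed
  finally show "(\<integral>t. bump k l t \<partial>unit_measure) = 1 / real k" .
qed

lemma step_fun_cell_fun: "step_fun N (cell_fun N k \<kappa>)"
  unfolding cell_fun_def bump_def
  by (intro step_fun_prod step_fun_diff step_fun.atom threshold_nonneg) auto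

lemma integral_cell_fun:
  assumes "\<kappa> \<in> grid_cells N (\<lambda>_. k)"
  shows "(\<integral>w. cell_fun N k \<kappa> w \<partial>uniform_cube N) = (1 / real k) ^ N"
proof -
  have \<kappa>: "\<kappa> c < k" if "c < N" for c
    using assms that by (auto simp: grid_cells_def dest!: PiE_mem)
  have "(\<integral>w. cell_fun N k \<kappa> w \<partial>uniform_cube N) = (\<Prod>c<N. \<integral>t. bump k (\<kappa> c) t \<partial>unit_measure)"
    unfolding cell_fun_def using \<kappa> by (intro integral_uniform_cube_prod integral_bump)
  also have "\<dots> = (\<Prod>c<N. 1 / real k)"
    using \<kappa> by (intro prod.cong integral_bump) auto
  finally show ?thesis by simp
qed

lemma cube_coord: "w \<in> cube N \<Longrightarrow> c < N \<Longrightarrow> 0 \<le> w c \<and> w c \<le> 1"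
  by (auto simp: cube_def dest!: PiE_mem)

lemma cell_fun_eq:
  assumes "k \<ge> 1" "w \<in> cube N"
  shows "cell_fun N k \<kappa> w = of_bool (\<forall>c<N. \<kappa> c = cell_index k (w c))"
proof -
  have "cell_fun N k \<kappa> w = (\<Prod>c<N. of_bool (\<kappa> c = cell_index k (w c)))"
    unfolding cell_fun_def using assms cube_coord by (intro prod.cong bump_eq) auto
  then show ?thesis by (simp add: prod_of_bool)
qed

text \<open>Step functions use half-open cells, Riemann sums take tags in closed ones. The inclusion
  lets bounds on a closed cell apply to the points of the half-open one.\<close>

lemma cell_fun_in_cell:
  assumes "k \<ge> 1" "w \<in> cube N" "cell_fun N k \<kappa> w \<noteq> 0"
  shows "w \<in> uniform_cell N k \<kappa>"
proof -
  have \<kappa>: "\<kappa> c = cell_index k (w c)" if "c < N" for c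
    using cell_fun_eq[OF assms(1,2), of \<kappa>] assms(3) that by (simp split: if_splits)
  have "w c \<in> {real (\<kappa> c) / real k..real (Suc (\<kappa> c)) / real k}" if c: "c < N" for c
  proof -
    note w = cube_coord[OF assms(2) c]
    have "\<not> w c < threshold k (\<kappa> c)" "w c < threshold k (Suc (\<kappa> c))"
      using less_threshold_iff[OF assms(1)] w \<kappa>[OF c] by auto
    moreover have "\<kappa> c < k" using cell_index_less[OF assms(1)] \<kappa>[OF c] by simp
    ultimately have low: "real (\<kappa> c) / real k \<le> w c"
      by (simp add: threshold_def)
    have "w c \<le> real (Suc (\<kappa> c)) / real k"
    proof (cases "Suc (\<kappa> c) < k")
      case True
      then show ?thesis using \<open>w c < threshold k (Suc (\<kappa> c))\<close> by (simp add: threshold_def)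
    next
      case False
      then have "Suc (\<kappa> c) = k" using \<open>\<kappa> c < k\<close> by simp
      then show ?thesis using w assms(1) by simp
    qed
    with low show ?thesis by simp
  qed
  moreover have "w \<in> extensional {..<N}" using assms(2) by (simp add: cube_def PiE_iff)
  ultimately show ?thesis by (simp add: cell_def PiE_iff)
qed

section \<open>From Riemann sums on uniform grids to step functions\<close>

lemma uniform_cell_subset_cube:
  assumes "\<kappa> \<in> grid_cells N (\<lambda>_. k)"
  shows "uniform_cell N k \<kappa> \<subseteq> cube N"
  unfolding cell_def cube_def
proof (rule PiE_mono)
  fix c assume "c \<in> {..<N}"
  then have "\<kappa> c < k" using assms by (auto simp: grid_cells_def dest!: PiE_mem)
  then have "real (Suc (\<kappa> c)) / real k \<le> 1" by (simp add: divide_le_eq_1)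
  then show "{real (\<kappa> c) / real k..real (Suc (\<kappa> c)) / real k} \<subseteq> {0..1}"
    by (auto intro: order_trans[rotated])
qed

lemma uniform_cell_nonempty: "uniform_cell N k \<kappa> \<noteq> {}"
  by (auto simp: cell_def PiE_eq_empty_iff divide_right_mono)

text \<open>The mesh \<open>1 / real k\<close> is pushed below \<open>\<delta>\<close>. The tags
  stay universally quantified because later proofs choose special ones.\<close>

lemma has_riemann_integral_uniform_grid:
  assumes g: "has_riemann_integral N g I" and e: "e > 0"
  obtains k where "k \<ge> 1"
    and "\<And>\<tau>. (\<And>\<kappa>. \<kappa> \<in> grid_cells N (\<lambda>_. k) \<Longrightarrow> \<tau> \<kappa> \<in> uniform_cell N k \<kappa>) \<Longrightarrow>
      \<bar>(\<Sum>\<kappa>\<in>grid_cells N (\<lambda>_. k). g (\<tau> \<kappa>) * (1 / real k) ^ N) - I\<bar> < e"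
proof -
  obtain \<delta> where \<delta>: "\<delta> > 0" and riemann: "\<And>n p \<tau>. grid N n p \<Longrightarrow> mesh_less N n p \<delta> \<Longrightarrow>
        (\<forall>\<kappa>\<in>grid_cells N n. \<tau> \<kappa> \<in> cell N p \<kappa>) \<Longrightarrow>
        \<bar>(\<Sum>\<kappa>\<in>grid_cells N n. g (\<tau> \<kappa>) * cell_volume N p \<kappa>) - I\<bar> < e"
    using g e unfolding has_riemann_integral_def by blast
  obtain k0 where k0: "inverse (real (Suc k0)) < \<delta>"
    using reals_Archimedean[OF \<delta>] by blast
  define k where "k = Suc k0"
  define p :: "nat \<Rightarrow> nat \<Rightarrow> real" where "p = (\<lambda>_ l. real l / real k)"
  have k: "k \<ge> 1" by (simp add: k_def)
  have diff: "p c (Suc l) - p c l = 1 / real k" for c l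
    by (simp add: p_def diff_divide_distrib[symmetric])
  show thesis
  proof (rule that[OF k])
    fix \<tau> assume \<tau>: "\<And>\<kappa>. \<kappa> \<in> grid_cells N (\<lambda>_. k) \<Longrightarrow> \<tau> \<kappa> \<in> uniform_cell N k \<kappa>"
    have "grid N (\<lambda>_. k) p"
      using k by (simp add: grid_def p_def divide_strict_right_mono)
    moreover have "mesh_less N (\<lambda>_. k) p \<delta>"
      using k0 by (simp add: mesh_less_def diff k_def inverse_eq_divide)
    ultimately have "\<bar>(\<Sum>\<kappa>\<in>grid_cells N (\<lambda>_. k). g (\<tau> \<kappa>) * cell_volume N p \<kappa>) - I\<bar> < e"
      using \<tau> by (intro riemann) (simp_all add: p_def)
    then show "\<bar>(\<Sum>\<kappa>\<in>grid_cells N (\<lambda>_. k). g (\<tau> \<kappa>) * (1 / real k) ^ N) - I\<bar> < e"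
      by (simp add: cell_volume_def diff)
  qed
qed

text \<open>With tags that maximise \<open>g\<close> on every cell up to \<open>e / 2\<close>, the
  step function of the tag values plus \<open>e / 2\<close> lies above \<open>g\<close>, while its
  integral is a Riemann sum plus \<open>e / 2\<close>. The bound \<open>B\<close> makes the suprema
  meaningful.\<close>

lemma riemann_upper_step_fun:
  assumes g: "has_riemann_integral N g I" and B: "\<And>w. w \<in> cube N \<Longrightarrow> \<bar>g w\<bar> \<le> B" and e: "e > 0"
  obtains h where "step_fun N h" "\<And>w. w \<in> cube N \<Longrightarrow> g w \<le> h w"
    "(\<integral>w. h w \<partial>uniform_cube N) \<le> I + e"
proof -
  have e2: "e / 2 > 0" using e by simp
  obtain k where k: "k \<ge> 1"
    and riemann: "\<And>\<tau>. (\<And>\<kappa>. \<kappa> \<in> grid_cells N (\<lambda>_. k) \<Longrightarrow> \<tau> \<kappa> \<in> uniform_cell N k \<kappa>) \<Longrightarrow>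
      \<bar>(\<Sum>\<kappa>\<in>grid_cells N (\<lambda>_. k). g (\<tau> \<kappa>) * (1 / real k) ^ N) - I\<bar> < e / 2"
    using has_riemann_integral_uniform_grid[OF g e2] by metis
  let ?K = "grid_cells N (\<lambda>_. k)"
  have fin: "finite ?K" unfolding grid_cells_def by (intro finite_PiE) auto
  have "\<exists>z\<in>uniform_cell N k \<kappa>. \<forall>w\<in>uniform_cell N k \<kappa>. g w \<le> g z + e / 2" if \<kappa>: "\<kappa> \<in> ?K" for \<kappa>
  proof -
    let ?S = "Sup (g ` uniform_cell N k \<kappa>)"
    have bdd: "bdd_above (g ` uniform_cell N k \<kappa>)"
      using uniform_cell_subset_cube[OF \<kappa>] B by (intro bdd_aboveI2[where M=B]) (meson abs_le_D1 subsetD)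
    have "?S - e / 2 < ?S" using e by simp
    then obtain z where z: "z \<in> uniform_cell N k \<kappa>" "?S - e / 2 < g z"
      using less_cSup_iff[OF _ bdd, of "?S - e / 2"] uniform_cell_nonempty by blast
    have "g w \<le> ?S" if "w \<in> uniform_cell N k \<kappa>" for w
      using that bdd by (rule cSUP_upper)
    with z show ?thesis by (intro bexI[of _ z] ballI) force+
  qed
  then obtain \<tau> where \<tau>: "\<And>\<kappa>. \<kappa> \<in> ?K \<Longrightarrow> \<tau> \<kappa> \<in> uniform_cell N k \<kappa>"
    and \<tau>_max: "\<And>\<kappa> w. \<kappa> \<in> ?K \<Longrightarrow> w \<in> uniform_cell N k \<kappa> \<Longrightarrow> g w \<le> g (\<tau> \<kappa>) + e / 2"
    by metis
  define h where "h w = e / 2 + (\<Sum>\<kappa>\<in>?K. g (\<tau> \<kappa>) * cell_fun N k \<kappa> w)" for w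
  have int: "integrable (uniform_cube N) (cell_fun N k \<kappa>)" for \<kappa>
    by (rule step_fun_integrable[OF step_fun_cell_fun])
  show thesis
  proof
    show "step_fun N h"
      unfolding h_def using fin
      by (intro step_fun.add step_fun.const step_fun_sum step_fun_cmult step_fun_cell_fun)
    interpret prob_space "uniform_cube N" by (rule prob_space_uniform_cube)
    have "(\<integral>w. h w \<partial>uniform_cube N) = e / 2 + (\<Sum>\<kappa>\<in>?K. g (\<tau> \<kappa>) * (1 / real k) ^ N)"
      unfolding h_def using int by (simp add: integral_cell_fun prob_space del: power_one_over)
    also have "\<dots> \<le> e / 2 + (I + e / 2)"
      using riemann[OF \<tau>] by (intro add_left_mono) linarith
    finally show "(\<integral>w. h w \<partial>uniform_cube N) \<le> I + e" by simp
    fix w assume w: "w \<in> cube N"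
    \<comment> \<open>The index of the half-open cell around \<open>w\<close>; these cells are
      disjoint, so all other summands vanish.\<close>
    define \<kappa>0 where "\<kappa>0 = (\<lambda>c\<in>{..<N}. cell_index k (w c))"
    have \<kappa>0: "\<kappa>0 \<in> ?K"
      using cell_index_less[OF k] by (auto simp: \<kappa>0_def grid_cells_def)
    have "cell_fun N k \<kappa> w = (if \<kappa> = \<kappa>0 then 1 else 0)" if "\<kappa> \<in> ?K" for \<kappa>
    proof -
      have "(\<forall>c<N. \<kappa> c = cell_index k (w c)) \<longleftrightarrow> \<kappa> = \<kappa>0"
        using that by (auto simp: \<kappa>0_def grid_cells_def PiE_iff intro!: extensionalityI[where A="{..<N}"])
      then show ?thesis by (simp add: cell_fun_eq[OF k w])
    qed
    then have "(\<Sum>\<kappa>\<in>?K. g (\<tau> \<kappa>) * cell_fun N k \<kappa> w) = (\<Sum>\<kappa>\<in>?K. if \<kappa> = \<kappa>0 then g (\<tau> \<kappa>) else 0)"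
      by (intro sum.cong) auto
    then have "h w = e / 2 + g (\<tau> \<kappa>0)"
      using fin \<kappa>0 by (simp add: h_def)
    moreover have "w \<in> uniform_cell N k \<kappa>0"
      by (rule cell_fun_in_cell[OF k w]) (simp add: cell_fun_eq[OF k w] \<kappa>0_def)
    ultimately show "g w \<le> h w" using \<tau>_max[OF \<kappa>0] by (simp add: add.commute)
  qed
qed

lemma has_riemann_integral_uminus:
  assumes "has_riemann_integral N g I"
  shows "has_riemann_integral N (\<lambda>w. - g w) (- I)"
proof -
  have "\<bar>(\<Sum>\<kappa>\<in>K. - g (\<tau> \<kappa>) * V \<kappa>) - (- I)\<bar> = \<bar>(\<Sum>\<kappa>\<in>K. g (\<tau> \<kappa>) * V \<kappa>) - I\<bar>" for K \<tau> and V :: "(nat \<Rightarrow> nat) \<Rightarrow> real"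
    by (simp add: sum_negf)
  then show ?thesis using assms unfolding has_riemann_integral_def by presburger
qed

lemma riemann_lower_step_fun:
  assumes g: "has_riemann_integral N g I" and B: "\<And>w. w \<in> cube N \<Longrightarrow> \<bar>g w\<bar> \<le> B" and e: "e > 0"
  obtains h where "step_fun N h" "\<And>w. w \<in> cube N \<Longrightarrow> h w \<le> g w"
    "I - e \<le> (\<integral>w. h w \<partial>uniform_cube N)"
proof -
  obtain h where h: "step_fun N h" "\<And>w. w \<in> cube N \<Longrightarrow> - g w \<le> h w"
    "(\<integral>w. h w \<partial>uniform_cube N) \<le> - I + e"
    using riemann_upper_step_fun[OF has_riemann_integral_uminus[OF g], of B e] B e by auto
  show thesis
  proof
    show "step_fun N (\<lambda>w. -1 * h w)" by (rule step_fun_cmult[OF h(1)])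
    show "-1 * h w \<le> g w" if "w \<in> cube N" for w using h(2)[OF that] by simp
    show "I - e \<le> (\<integral>w. -1 * h w \<partial>uniform_cube N)" using h(3) by simp
  qed
qed

text \<open>If every cell met the complement of \<open>C\<close>, tags taken there would give the
  Riemann sum 0, which is not within the strict tolerance \<open>J\<close> of
  \<open>J\<close>.\<close>

lemma positive_jordan_measure_contains_cell:
  assumes "has_jordan_measure N C J" "J > 0"
  obtains k \<kappa> where "k \<ge> 1" "\<kappa> \<in> grid_cells N (\<lambda>_. k)" "uniform_cell N k \<kappa> \<subseteq> C"
proof -
  obtain k where k: "k \<ge> 1"
    and riemann: "\<And>\<tau>. (\<And>\<kappa>. \<kappa> \<in> grid_cells N (\<lambda>_. k) \<Longrightarrow> \<tau> \<kappa> \<in> uniform_cell N k \<kappa>) \<Longrightarrow>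
      \<bar>(\<Sum>\<kappa>\<in>grid_cells N (\<lambda>_. k). indicator C (\<tau> \<kappa>) * (1 / real k) ^ N) - J\<bar> < J"
    using has_riemann_integral_uniform_grid[of N "indicator C" J J] assms
    unfolding has_jordan_measure_def by metis
  have "\<exists>\<kappa>\<in>grid_cells N (\<lambda>_. k). uniform_cell N k \<kappa> \<subseteq> C"
  proof (rule ccontr)
    assume "\<not> ?thesis"
    then obtain \<tau> where \<tau>: "\<And>\<kappa>. \<kappa> \<in> grid_cells N (\<lambda>_. k) \<Longrightarrow> \<tau> \<kappa> \<in> uniform_cell N k \<kappa> \<and> \<tau> \<kappa> \<notin> C"
      unfolding subset_iff by metis
    then have "(\<Sum>\<kappa>\<in>grid_cells N (\<lambda>_. k). indicator C (\<tau> \<kappa>) * (1 / real k) ^ N) = (0::real)"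
      by (intro sum.neutral) auto
    then show False using riemann[of \<tau>] \<tau> assms(2) by auto
  qed
  then show thesis using k that by blast
qed

section \<open>The Markov chain\<close>

definition concat_point :: "nat \<Rightarrow> nat \<Rightarrow> point \<Rightarrow> point \<Rightarrow> point" where
  "concat_point a b w z = (\<lambda>i\<in>{..<a + b}. if i < a then w i else z (i - a))"

lemma measurable_concat_point:
  "(\<lambda>(w, z). concat_point a b w z) \<in> uniform_cube a \<Otimes>\<^sub>M uniform_cube b \<rightarrow>\<^sub>M uniform_cube (a + b)"
  unfolding concat_point_def split_beta' uniform_cube_eq
proof (rule measurable_restrict)
  fix i assume i: "i \<in> {..<a + b}"
  show "(\<lambda>p. if i < a then fst p i else snd p (i - a))
      \<in> (\<Pi>\<^sub>M i\<in>{..<a}. unit_measure) \<Otimes>\<^sub>M (\<Pi>\<^sub>M i\<in>{..<b}. unit_measure) \<rightarrow>\<^sub>M unit_measure"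
  proof (cases "i < a")
    case True
    then show ?thesis
      using measurable_compose[OF measurable_fst measurable_component_singleton[of i "{..<a}"]] by simp
  next
    case False
    then show ?thesis
      using i measurable_compose[OF measurable_snd measurable_component_singleton[of "i - a" "{..<b}"]] by simp
  qed
qed

text \<open>A finite product measure is determined by its values on product boxes. The preimage of a
  box splits into the sides below \<open>a\<close> and the remaining ones, and its measure is the
  product over both groups.\<close>

lemma distr_concat_point:
  "distr (uniform_cube a \<Otimes>\<^sub>M uniform_cube b) (uniform_cube (a + b)) (\<lambda>(w, z). concat_point a b w z)
     = uniform_cube (a + b)"
proof -
  interpret U: product_sigma_finite "\<lambda>_::nat. unit_measure" by (rule product_sigma_finite_unit)
  interpret Ub: prob_space "uniform_cube b" by (rule prob_space_uniform_cube)
  let ?D = "distr (uniform_cube a \<Otimes>\<^sub>M uniform_cube b) (uniform_cube (a + b)) (\<lambda>(w, z). concat_point a b w z)"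
  have "?D = (\<Pi>\<^sub>M i\<in>{..<a + b}. unit_measure)"
  proof (rule U.PiM_eqI)
    show "sets ?D = sets (\<Pi>\<^sub>M i\<in>{..<a + b}. unit_measure)"
      by (simp add: uniform_cube_eq)
    fix A :: "nat \<Rightarrow> real set" assume A: "\<And>i. i \<in> {..<a + b} \<Longrightarrow> A i \<in> sets unit_measure"
    have A1: "A i \<in> sets unit_measure" if "i \<in> {..<a}" for i using A that by auto
    have A2: "A (i + a) \<in> sets unit_measure" if "i \<in> {..<b}" for i using A that by auto
    have sub: "A i \<subseteq> {0..1}" if "i < a + b" for i
      using sets.sets_into_space[OF A] that by (auto simp: space_unit_measure)
    have "(\<lambda>(w, z). concat_point a b w z) -` (\<Pi>\<^sub>E i\<in>{..<a + b}. A i) \<inter> space (uniform_cube a \<Otimes>\<^sub>M uniform_cube b)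
        = (\<Pi>\<^sub>E i\<in>{..<a}. A i) \<times> (\<Pi>\<^sub>E i\<in>{..<b}. A (i + a))" (is "?L = ?R")
    proof (intro set_eqI iffI)
      fix p assume p: "p \<in> ?L"
      obtain w z where wz: "p = (w, z)" by (cases p)
      have mem: "concat_point a b w z i \<in> A i" if "i < a + b" for i
        using p that by (auto simp: wz dest!: PiE_mem)
      have "w i \<in> A i" if "i < a" for i
        using mem[of i] that by (simp add: concat_point_def)
      moreover have "z i \<in> A (i + a)" if "i < b" for i
        using mem[of "i + a"] that by (simp add: concat_point_def)
      moreover have "w \<in> extensional {..<a}" "z \<in> extensional {..<b}"
        using p by (auto simp: wz space_pair_measure space_uniform_cube cube_def PiE_iff)
      ultimately show "p \<in> ?R" by (simp add: wz PiE_iff)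
    next
      fix p assume p: "p \<in> ?R"
      obtain w z where wz: "p = (w, z)" by (cases p)
      have w: "w i \<in> A i" if "i < a" for i using p that by (auto simp: wz PiE_iff)
      have z: "z i \<in> A (i + a)" if "i < b" for i using p that by (auto simp: wz PiE_iff)
      have "concat_point a b w z i \<in> A i" if "i < a + b" for i
        using w[of i] z[of "i - a"] that by (cases "i < a") (auto simp: concat_point_def)
      then have "concat_point a b w z \<in> (\<Pi>\<^sub>E i\<in>{..<a + b}. A i)"
        by (simp add: PiE_iff concat_point_def)
      moreover have "(\<Pi>\<^sub>E i\<in>{..<a}. A i) \<subseteq> cube a" "(\<Pi>\<^sub>E i\<in>{..<b}. A (i + a)) \<subseteq> cube b"
        unfolding cube_def by (intro PiE_mono sub; simp)+
      then have "w \<in> cube a" "z \<in> cube b"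
        using p wz by auto
      ultimately show "p \<in> ?L"
        by (simp add: wz space_pair_measure space_uniform_cube)
    qed
    then have "emeasure ?D (\<Pi>\<^sub>E i\<in>{..<a + b}. A i)
        = emeasure (uniform_cube a \<Otimes>\<^sub>M uniform_cube b) ((\<Pi>\<^sub>E i\<in>{..<a}. A i) \<times> (\<Pi>\<^sub>E i\<in>{..<b}. A (i + a)))"
      using A by (subst emeasure_distr[OF measurable_concat_point])
        (auto simp: uniform_cube_eq intro!: sets_PiM_I_finite)
    also have "\<dots> = (\<Prod>i<a. emeasure unit_measure (A i)) * (\<Prod>i<b. emeasure unit_measure (A (i + a)))"
    proof (subst Ub.emeasure_pair_measure_Times)
      show "(\<Pi>\<^sub>E i\<in>{..<a}. A i) \<in> sets (uniform_cube a)"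
        unfolding uniform_cube_eq by (rule sets_PiM_I_finite) (use A1 in auto)
      show "(\<Pi>\<^sub>E i\<in>{..<b}. A (i + a)) \<in> sets (uniform_cube b)"
        unfolding uniform_cube_eq by (rule sets_PiM_I_finite) (use A2 in auto)
      show "emeasure (uniform_cube a) (\<Pi>\<^sub>E i\<in>{..<a}. A i) * emeasure (uniform_cube b) (\<Pi>\<^sub>E i\<in>{..<b}. A (i + a))
          = (\<Prod>i<a. emeasure unit_measure (A i)) * (\<Prod>i<b. emeasure unit_measure (A (i + a)))"
        unfolding uniform_cube_eq using A1 A2 by (intro arg_cong2[where f="(*)"] U.emeasure_PiM) auto
    qed
    also have "(\<Prod>i<b. emeasure unit_measure (A (i + a))) = (\<Prod>i\<in>{a..<a + b}. emeasure unit_measure (A i))"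
      using prod.shift_bounds_nat_ivl[of "\<lambda>i. emeasure unit_measure (A i)" 0 a b]
      by (simp add: atLeast0LessThan add.commute)
    also have "(\<Prod>i<a. emeasure unit_measure (A i)) * \<dots> = (\<Prod>i\<in>{..<a + b}. emeasure unit_measure (A i))"
      by (subst prod.union_disjoint[symmetric]) (auto intro!: prod.cong)
    finally show "emeasure ?D (\<Pi>\<^sub>E i\<in>{..<a + b}. A i) = (\<Prod>i\<in>{..<a + b}. emeasure unit_measure (A i))" .
  qed simp
  then show ?thesis by (simp add: uniform_cube_eq)
qed

lemma integral_concat_point:
  fixes h :: "point \<Rightarrow> real"
  assumes h: "integrable (uniform_cube (a + b)) h"
  shows "(\<integral>w. h w \<partial>uniform_cube (a + b))
    = (\<integral>w. (\<integral>z. h (concat_point a b w z) \<partial>uniform_cube b) \<partial>uniform_cube a)"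
proof -
  interpret Ua: prob_space "uniform_cube a" by (rule prob_space_uniform_cube)
  interpret Ub: prob_space "uniform_cube b" by (rule prob_space_uniform_cube)
  interpret pair_sigma_finite "uniform_cube a" "uniform_cube b" ..
  let ?P = "uniform_cube a \<Otimes>\<^sub>M uniform_cube b"
  note h_meas = borel_measurable_integrable[OF h]
  have "integrable (distr ?P (uniform_cube (a + b)) (\<lambda>(w, z). concat_point a b w z)) h"
    using h by (simp add: distr_concat_point)
  then have int: "integrable ?P (\<lambda>p. h (case p of (w, z) \<Rightarrow> concat_point a b w z))"
    by (simp add: integrable_distr_eq[OF measurable_concat_point h_meas])
  have "(\<integral>w. h w \<partial>uniform_cube (a + b))
      = (\<integral>w. h w \<partial>distr ?P (uniform_cube (a + b)) (\<lambda>(w, z). concat_point a b w z))"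
    by (simp add: distr_concat_point)
  also have "\<dots> = (\<integral>p. h (case p of (w, z) \<Rightarrow> concat_point a b w z) \<partial>?P)"
    by (rule integral_distr[OF measurable_concat_point h_meas])
  also have "\<dots> = (\<integral>w. (\<integral>z. h (concat_point a b w z) \<partial>uniform_cube b) \<partial>uniform_cube a)"
    using integral_fst'[OF int] by simp
  finally show ?thesis .
qed

section \<open>The chain driven by the blocks of one point\<close>

lemma block_in_cube:
  assumes "w \<in> cube N" "d * i + d \<le> N"
  shows "block d w i \<in> cube d"
proof -
  have "w (d * i + j) \<in> {0..1}" if "j < d" for j
    using cube_coord[OF assms(1), of "d * i + j"] assms(2) that by simp
  then show ?thesis by (simp add: block_def cube_def)
qed

lemma block_concat_point_left: "d * i + d \<le> a \<Longrightarrow> block d (concat_point a b w z) i = block d w i"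
  by (auto simp: block_def concat_point_def fun_eq_iff)

lemma block_concat_point_right: "z \<in> cube d \<Longrightarrow> block d (concat_point (d * i) d w z) i = z"
  by (auto simp: block_def concat_point_def cube_def fun_eq_iff PiE_iff extensional_def)

lemma measurable_block:
  assumes "d * i + d \<le> N"
  shows "(\<lambda>w. block d w i) \<in> uniform_cube N \<rightarrow>\<^sub>M uniform_cube d"
  unfolding block_def uniform_cube_eq
  using assms by (intro measurable_restrict measurable_component_singleton) auto

text \<open>Block 0 is skipped: it is reserved for the start of the Rosenblatt-Chentsov chain, which
  thus becomes a run whose initial state depends on block 0 alone.\<close>

primrec run :: "(point \<Rightarrow> point \<Rightarrow> point) \<Rightarrow> nat \<Rightarrow> point \<Rightarrow> point \<Rightarrow> nat \<Rightarrow> point" where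
  "run \<phi> d x w 0 = x"
| "run \<phi> d x w (Suc m) = \<phi> (run \<phi> d x w m) (block d w (Suc m))"

lemma chentsov_eq_run: "chentsov s F \<phi> (block d w) m = run \<phi> d (chentsov s F \<phi> (block d w) 0) w m"
  by (induction m) auto

lemma run_concat_point:
  "d * m + d \<le> a \<Longrightarrow> run \<phi> d x (concat_point a b w z) m = run \<phi> d x w m"
  by (induction m) (auto simp: block_concat_point_left)

section \<open>Stationarity along a run\<close>

locale mcmc =
  fixes s d :: nat and \<Omega> :: "point set" and \<pi> :: "point \<Rightarrow> real" and \<phi> :: "point \<Rightarrow> point \<Rightarrow> point"
  assumes density: "probability_density s \<Omega> \<pi>"
    and update: "update_function s d \<Omega> \<pi> \<phi>"
begin

lemma space_state: "space (state_space s \<Omega>) = \<Omega>"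
proof -
  have "\<Omega> \<in> sets (leb s)" using density by (simp add: probability_density_def)
  then show ?thesis
    using sets.sets_into_space by (auto simp: state_space_def space_restrict_space)
qed

lemma sets_target: "sets (target s \<Omega> \<pi>) = sets (state_space s \<Omega>)"
  by (simp add: target_def)

lemma space_target: "space (target s \<Omega> \<pi>) = \<Omega>"
  by (simp add: target_def space_state)

lemma prob_space_target: "prob_space (target s \<Omega> \<pi>)"
  using density by (simp add: probability_density_def)

lemma measurable_update: "case_prod \<phi> \<in> state_space s \<Omega> \<Otimes>\<^sub>M uniform_cube d \<rightarrow>\<^sub>M state_space s \<Omega>"
  using update by (simp add: update_function_def)

lemma distr_update:
  "distr (target s \<Omega> \<pi> \<Otimes>\<^sub>M uniform_cube d) (state_space s \<Omega>) (case_prod \<phi>) = target s \<Omega> \<pi>"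
  using update by (simp add: update_function_def)

lemma update_in:
  assumes "x \<in> \<Omega>" "z \<in> cube d"
  shows "\<phi> x z \<in> \<Omega>"
proof -
  have "(x, z) \<in> space (state_space s \<Omega> \<Otimes>\<^sub>M uniform_cube d)"
    using assms by (simp add: space_pair_measure space_state space_uniform_cube)
  from measurable_space[OF measurable_update this] show ?thesis by (simp add: space_state)
qed

lemma run_in: "x \<in> \<Omega> \<Longrightarrow> w \<in> cube N \<Longrightarrow> d * m + d \<le> N \<Longrightarrow> run \<phi> d x w m \<in> \<Omega>"
proof (induction m)
  case (Suc m)
  then have "run \<phi> d x w m \<in> \<Omega>" by simp
  then show ?case using Suc.prems block_in_cube[of w N d "Suc m"] by (auto intro: update_in)
qed simp

lemma measurable_run:
  "d * m + d \<le> N \<Longrightarrow>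
    (\<lambda>p. run \<phi> d (fst p) (snd p) m) \<in> state_space s \<Omega> \<Otimes>\<^sub>M uniform_cube N \<rightarrow>\<^sub>M state_space s \<Omega>"
proof (induction m)
  case (Suc m)
  then have "(\<lambda>p. run \<phi> d (fst p) (snd p) m) \<in> state_space s \<Omega> \<Otimes>\<^sub>M uniform_cube N \<rightarrow>\<^sub>M state_space s \<Omega>"
    by simp
  moreover have "(\<lambda>p. block d (snd p) (Suc m)) \<in> state_space s \<Omega> \<Otimes>\<^sub>M uniform_cube N \<rightarrow>\<^sub>M uniform_cube d"
    using Suc.prems by (intro measurable_compose[OF measurable_snd] measurable_block)
  ultimately have "(\<lambda>p. (run \<phi> d (fst p) (snd p) m, block d (snd p) (Suc m)))
      \<in> state_space s \<Omega> \<Otimes>\<^sub>M uniform_cube N \<rightarrow>\<^sub>M state_space s \<Omega> \<Otimes>\<^sub>M uniform_cube d"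
    by (rule measurable_Pair)
  from measurable_compose[OF this measurable_update] show ?case by simp
qed simp

lemma integrable_run:
  fixes f :: "point \<Rightarrow> real"
  assumes f: "f \<in> borel_measurable (state_space s \<Omega>)" "\<forall>x\<in>\<Omega>. \<bar>f x\<bar> \<le> B"
    and x: "x \<in> \<Omega>" and N: "d * m + d \<le> N"
  shows "integrable (uniform_cube N) (\<lambda>w. f (run \<phi> d x w m))"
proof -
  interpret prob_space "uniform_cube N" by (rule prob_space_uniform_cube)
  have "(\<lambda>w. (x, w)) \<in> uniform_cube N \<rightarrow>\<^sub>M state_space s \<Omega> \<Otimes>\<^sub>M uniform_cube N"
    using x by (intro measurable_Pair1') (simp add: space_state)
  from measurable_compose[OF measurable_compose[OF this measurable_run[OF N]] f(1)]
  have "(\<lambda>w. f (run \<phi> d x w m)) \<in> borel_measurable (uniform_cube N)" by simp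
  then show ?thesis
    using f(2) run_in[OF x _ N] by (intro integrable_const_bound[where B=B] AE_I2) (auto simp: space_uniform_cube)
qed

lemma integrable_target:
  fixes f :: "point \<Rightarrow> real"
  assumes "f \<in> borel_measurable (state_space s \<Omega>)" "\<forall>x\<in>\<Omega>. \<bar>f x\<bar> \<le> B"
  shows "integrable (target s \<Omega> \<pi>) f"
proof -
  interpret prob_space "target s \<Omega> \<pi>" by (rule prob_space_target)
  have "f \<in> borel_measurable (target s \<Omega> \<pi>)"
    using assms(1) by (simp add: target_def)
  then show ?thesis
    using assms(2) by (intro integrable_const_bound[where B=B] AE_I2) (auto simp: space_target)
qed

text \<open>Stationarity tested against \<open>f\<close>: Fubini turns the integral of
  \<open>h\<close> into one over the joint law, whose image under the update is the target.
  Measurability and the bound pass to \<open>h\<close>, so the step can be iterated.\<close>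

lemma integral_update:
  fixes f :: "point \<Rightarrow> real"
  assumes f: "f \<in> borel_measurable (state_space s \<Omega>)" "\<forall>x\<in>\<Omega>. \<bar>f x\<bar> \<le> B"
  defines "h \<equiv> \<lambda>x. \<integral>z. f (\<phi> x z) \<partial>uniform_cube d"
  shows "h \<in> borel_measurable (state_space s \<Omega>)" "\<forall>x\<in>\<Omega>. \<bar>h x\<bar> \<le> B"
    and "(\<integral>x. h x \<partial>target s \<Omega> \<pi>) = (\<integral>x. f x \<partial>target s \<Omega> \<pi>)"
proof -
  interpret T: prob_space "target s \<Omega> \<pi>" by (rule prob_space_target)
  interpret U: prob_space "uniform_cube d" by (rule prob_space_uniform_cube)
  interpret pair_prob_space "target s \<Omega> \<pi>" "uniform_cube d" ..
  let ?P = "target s \<Omega> \<pi> \<Otimes>\<^sub>M uniform_cube d"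
  have f\<phi>: "(\<lambda>(x, z). f (\<phi> x z)) \<in> borel_measurable (state_space s \<Omega> \<Otimes>\<^sub>M uniform_cube d)"
    using measurable_compose[OF measurable_update f(1)] by (simp add: split_beta')
  then show "h \<in> borel_measurable (state_space s \<Omega>)"
    unfolding h_def by (rule U.borel_measurable_lebesgue_integral)
  show "\<forall>x\<in>\<Omega>. \<bar>h x\<bar> \<le> B"
  proof
    fix x assume x: "x \<in> \<Omega>"
    have bd: "\<bar>f (\<phi> x z)\<bar> \<le> B" if "z \<in> space (uniform_cube d)" for z
      using f(2) update_in[OF x] that by (simp add: space_uniform_cube)
    have "\<bar>h x\<bar> \<le> (\<integral>z. \<bar>f (\<phi> x z)\<bar> \<partial>uniform_cube d)"
      unfolding h_def by (rule integral_abs_bound)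
    also have "\<dots> \<le> B"
    proof (cases "integrable (uniform_cube d) (\<lambda>z. \<bar>f (\<phi> x z)\<bar>)")
      case True
      then show ?thesis using bd by (rule U.integral_le_const[OF _ AE_I2])
    next
      \<comment> \<open>Here the integral is 0 by default, and \<open>0 \<le> B\<close> because
        \<open>\<Omega>\<close> contains \<open>x\<close>.\<close>
      case False
      then show ?thesis
        using f(2) x by (force simp: not_integrable_integral_eq)
    qed
    finally show "\<bar>h x\<bar> \<le> B" .
  qed
  have sets_eq: "sets ?P = sets (state_space s \<Omega> \<Otimes>\<^sub>M uniform_cube d)"
    by (intro sets_pair_measure_cong sets_target refl)
  have meas: "case_prod \<phi> \<in> ?P \<rightarrow>\<^sub>M state_space s \<Omega>"
    using measurable_update measurable_cong_sets[OF sets_eq refl] by blast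
  have int: "integrable ?P (\<lambda>(x, z). f (\<phi> x z))"
  proof (rule P.integrable_const_bound[where B=B])
    show "(\<lambda>(x, z). f (\<phi> x z)) \<in> borel_measurable ?P"
      using f\<phi> measurable_cong_sets[OF sets_eq refl] by blast
    show "AE p in ?P. norm (case p of (x, z) \<Rightarrow> f (\<phi> x z)) \<le> B"
      by (rule AE_I2) (auto simp: space_pair_measure space_target space_uniform_cube intro!: f(2)[rule_format] update_in)
  qed
  have "(\<integral>x. h x \<partial>target s \<Omega> \<pi>) = (\<integral>p. f (case_prod \<phi> p) \<partial>?P)"
    using integral_fst'[OF int] by (simp add: h_def split_beta')
  also have "\<dots> = (\<integral>x. f x \<partial>distr ?P (state_space s \<Omega>) (case_prod \<phi>))"
    by (rule integral_distr[OF meas f(1), symmetric])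
  finally show "(\<integral>x. h x \<partial>target s \<Omega> \<pi>) = (\<integral>x. f x \<partial>target s \<Omega> \<pi>)"
    by (simp add: distr_update)
qed

text \<open>Induction peels off the last block: integrating over it replaces \<open>f\<close> by its
  one-step average, which has the same integral under the target. Hence \<open>f\<close> is kept
  arbitrary.\<close>

lemma integral_run:
  fixes f :: "point \<Rightarrow> real"
  assumes "f \<in> borel_measurable (state_space s \<Omega>)" "\<forall>x\<in>\<Omega>. \<bar>f x\<bar> \<le> B"
  shows "(\<integral>x. (\<integral>w. f (run \<phi> d x w m) \<partial>uniform_cube (d * (m + 1))) \<partial>target s \<Omega> \<pi>)
    = (\<integral>x. f x \<partial>target s \<Omega> \<pi>)"
  using assms
proof (induction m arbitrary: f)
  case 0
  interpret prob_space "uniform_cube d" by (rule prob_space_uniform_cube)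
  show ?case by (simp add: prob_space)
next
  case (Suc m)
  define h where "h = (\<lambda>x. \<integral>z. f (\<phi> x z) \<partial>uniform_cube d)"
  have h: "h \<in> borel_measurable (state_space s \<Omega>)" "\<forall>x\<in>\<Omega>. \<bar>h x\<bar> \<le> B"
    "(\<integral>x. h x \<partial>target s \<Omega> \<pi>) = (\<integral>x. f x \<partial>target s \<Omega> \<pi>)"
    unfolding h_def by (rule integral_update[OF Suc.prems(1) Suc.prems(2)])+
  let ?a = "d * (m + 1)"
  have N: "d * (Suc m + 1) = ?a + d" by simp
  have "(\<integral>w. f (run \<phi> d x w (Suc m)) \<partial>uniform_cube (d * (Suc m + 1)))
      = (\<integral>w. h (run \<phi> d x w m) \<partial>uniform_cube ?a)" if x: "x \<in> \<Omega>" for x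
  proof -
    have "(\<integral>w. f (run \<phi> d x w (Suc m)) \<partial>uniform_cube (?a + d))
        = (\<integral>w. (\<integral>z. f (run \<phi> d x (concat_point ?a d w z) (Suc m)) \<partial>uniform_cube d) \<partial>uniform_cube ?a)"
      by (intro integral_concat_point integrable_run[OF Suc.prems x]) auto
    also have "\<dots> = (\<integral>w. h (run \<phi> d x w m) \<partial>uniform_cube ?a)"
      unfolding h_def
    proof (intro Bochner_Integration.integral_cong refl)
      fix w z assume "z \<in> space (uniform_cube d)"
      then have "block d (concat_point ?a d w z) (Suc m) = z"
        using block_concat_point_right[of z d "m + 1" w] by (simp add: space_uniform_cube)
      moreover have "run \<phi> d x (concat_point ?a d w z) m = run \<phi> d x w m"
        by (rule run_concat_point) simp
      ultimately show "f (run \<phi> d x (concat_point ?a d w z) (Suc m)) = f (\<phi> (run \<phi> d x w m) z)"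
        by simp
    qed
    finally show ?thesis unfolding N .
  qed
  then have "(\<integral>x. (\<integral>w. f (run \<phi> d x w (Suc m)) \<partial>uniform_cube (d * (Suc m + 1))) \<partial>target s \<Omega> \<pi>)
      = (\<integral>x. (\<integral>w. h (run \<phi> d x w m) \<partial>uniform_cube ?a) \<partial>target s \<Omega> \<pi>)"
    by (intro Bochner_Integration.integral_cong[OF refl]) (simp only: space_target)
  also have "\<dots> = (\<integral>x. h x \<partial>target s \<Omega> \<pi>)"
    by (rule Suc.IH[OF h(1,2)])
  finally show ?case using h(3) by simp
qed

end

section \<open>Coupling and the sandwich by step functions\<close>

lemma block_end_le:
  assumes "i < m"
  shows "d * Suc i + d \<le> d * (m + 1)"
  using mult_le_mono2[of "Suc i + 1" "m + 1" d] assms by simp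

context mcmc
begin

text \<open>Two runs coincide right after a block in \<open>C\<close> and stay together since they
  use the same blocks. The induction distinguishes whether the last block lies in \<open>C\<close>
  or an earlier one does.\<close>

lemma run_coupled:
  assumes C: "\<forall>z\<in>C. \<forall>x\<in>\<Omega>. \<forall>x'\<in>\<Omega>. \<phi> x z = \<phi> x' z"
    and xx': "x \<in> \<Omega>" "x' \<in> \<Omega>" and w: "w \<in> cube N"
  shows "d * m + d \<le> N \<Longrightarrow> \<exists>i<m. block d w (Suc i) \<in> C \<Longrightarrow> run \<phi> d x w m = run \<phi> d x' w m"
proof (induction m)
  case (Suc m)
  have N: "d * m + d \<le> N" using Suc.prems(1) by simp
  show ?case
  proof (cases "block d w (Suc m) \<in> C")
    case True
    then show ?thesis
      unfolding run.simps using C run_in[OF xx'(1) w N] run_in[OF xx'(2) w N] by blast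
  next
    case False
    then have "\<exists>i<m. block d w (Suc i) \<in> C"
      using Suc.prems(2) less_antisym by blast
    then show ?thesis using Suc.IH[OF N] by simp
  qed
qed simp

text \<open>Continuity refers to the product topology on all coordinates, measurability to the first
  \<open>s\<close> only. The identity is measurable between the two, as the further coordinates are
  constantly \<open>undefined\<close> on the space of \<open>leb s\<close>.\<close>

lemma borel_measurable_continuous_on_state:
  fixes f :: "point \<Rightarrow> real"
  assumes "continuous_on \<Omega> f"
  shows "f \<in> borel_measurable (state_space s \<Omega>)"
proof -
  have "(\<lambda>x. x) \<in> leb s \<rightarrow>\<^sub>M (\<Pi>\<^sub>M i\<in>UNIV. borel)"
  proof (rule measurable_PiM_single')
    show "(\<lambda>x. x) \<in> space (leb s) \<rightarrow> (\<Pi>\<^sub>E i\<in>UNIV. space borel)" by simp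
    show "(\<lambda>x. x i) \<in> borel_measurable (leb s)" for i
    proof (cases "i < s")
      case True
      then have "(\<lambda>x. x i) \<in> leb s \<rightarrow>\<^sub>M lborel"
        unfolding leb_def by (intro measurable_component_singleton) simp
      then show ?thesis by simp
    next
      case False
      have "(\<lambda>x. x i) \<in> borel_measurable (leb s) \<longleftrightarrow> (\<lambda>_. undefined :: real) \<in> borel_measurable (leb s)"
        using False by (intro measurable_cong) (auto simp: leb_def space_PiM PiE_iff extensional_def)
      then show ?thesis by simp
    qed
  qed
  then have "(\<lambda>x. x) \<in> leb s \<rightarrow>\<^sub>M borel"
    using measurable_cong_sets[OF refl sets_PiM_equal_borel] by blast
  then have "(\<lambda>x. x) \<in> state_space s \<Omega> \<rightarrow>\<^sub>M restrict_space borel \<Omega>"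
    unfolding state_space_def by (rule measurable_restrict_space3) simp
  from measurable_compose[OF this borel_measurable_continuous_on_restrict[OF assms]]
  show ?thesis .
qed

lemma integral_target:
  fixes f :: "point \<Rightarrow> real"
  assumes "f \<in> borel_measurable (state_space s \<Omega>)"
  shows "(LINT y:\<Omega>|leb s. f y * \<pi> y) = (\<integral>x. f x \<partial>target s \<Omega> \<pi>)"
proof -
  have \<pi>: "\<Omega> \<in> sets (leb s)" "\<pi> \<in> borel_measurable (state_space s \<Omega>)" "\<forall>x\<in>\<Omega>. 0 \<le> \<pi> x"
    using density by (simp_all add: probability_density_def)
  have "(\<integral>x. f x \<partial>target s \<Omega> \<pi>) = (\<integral>x. \<pi> x *\<^sub>R f x \<partial>state_space s \<Omega>)"
    unfolding target_def using assms \<pi> by (intro integral_density AE_I2) (auto simp: space_state)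
  also have "\<dots> = (\<integral>x. indicator \<Omega> x *\<^sub>R (\<pi> x *\<^sub>R f x) \<partial>leb s)"
    unfolding state_space_def by (rule integral_restrict_space) (use \<pi>(1) in auto)
  finally show ?thesis
    by (simp add: set_lebesgue_integral_def mult.commute)
qed

text \<open>
  The bounds do not depend on the starting point \<open>x\<close>. Outside the set where \<open>err\<close> is at least
  \<open>2 * B\<close>, one of the blocks \<open>1, \<dots>, m\<close> lies in a grid cell inside the coupling region, so the
  chain started at \<open>x\<close> has merged with the Rosenblatt-Chentsov chain, whose values are controlled by
  Riemann integrability.
\<close>

lemma run_sandwich:
  fixes f :: "point \<Rightarrow> real"
  assumes regular: "regular_mcmc s d \<Omega> \<pi> \<phi> F" and coupling: "coupling_region d \<Omega> \<phi> C"
    and s: "1 \<le> s" "s \<le> d"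
    and f: "continuous_on \<Omega> f" and B: "B > 0" "\<And>x. x \<in> \<Omega> \<Longrightarrow> \<bar>f x\<bar> \<le> B"
    and e: "e > 0"
  obtains m g h where "step_fun (d * (m + 1)) g" "step_fun (d * (m + 1)) h"
    "\<And>x w. x \<in> \<Omega> \<Longrightarrow> w \<in> cube (d * (m + 1)) \<Longrightarrow>
      g w \<le> f (run \<phi> d x w m) \<and> f (run \<phi> d x w m) \<le> h w"
    "(\<integral>w. h w \<partial>uniform_cube (d * (m + 1))) \<le> (\<integral>w. g w \<partial>uniform_cube (d * (m + 1))) + e"
proof -
  obtain J where J: "J > 0" "has_jordan_measure d C J"
    and C: "\<forall>z\<in>C. \<forall>x\<in>\<Omega>. \<forall>x'\<in>\<Omega>. \<phi> x z = \<phi> x' z"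
    using coupling unfolding coupling_region_def by blast
  obtain k \<kappa> where k: "k \<ge> 1" and \<kappa>: "\<kappa> \<in> grid_cells d (\<lambda>_. k)" "uniform_cell d k \<kappa> \<subseteq> C"
    using positive_jordan_measure_contains_cell[OF J(2,1)] by metis
  define c where "c = (1 / real k) ^ d"
  have c: "0 < c" "c \<le> 1"
    using k by (auto simp: c_def power_le_one)
  \<comment> \<open>Chosen so that \<open>2 * B * (r + r) = e / 4\<close>, the bound on the integral
    of \<open>err\<close>.\<close>
  define r where "r = e / (16 * B)"
  have r: "r > 0" using e B(1) by (simp add: r_def)
  \<comment> \<open>After this many steps all blocks miss the chosen cell with probability below
    \<open>r\<close>.\<close>
  obtain m where m: "(1 - c) ^ m < r"
    using real_arch_pow_inv[OF r, of "1 - c"] c by auto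
  define N where "N = d * (m + 1)"
  have N: "N \<ge> 1" "s \<le> N" using s by (auto simp: N_def)
  define q where "q = cell_fun d k \<kappa>"
  define D where "D w = (\<Prod>i<m. 1 - q (block d w (Suc i)))" for w
  \<comment> \<open>The boundary must be cut out because \<open>G\<close> is 0 there instead of a
    value of the chain. Half-lines \<open>w j < a\<close> cannot isolate the value 0, so a strip of
    width \<open>\<eta>\<close> goes with it; over \<open>N\<close> coordinates the strips have
    total measure at most \<open>r\<close>.\<close>
  define \<eta> where "\<eta> = min 1 (r / N)"
  have \<eta>: "0 < \<eta>" "\<eta> \<le> 1" "\<eta> * N \<le> r"
    using r N by (auto simp: \<eta>_def min_def field_simps)
  define Z :: "point \<Rightarrow> real" where "Z w = 1 - (\<Prod>j<N. of_bool (w j < 1) - of_bool (w j < \<eta>))" for w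
  define err where "err w = 2 * B * (D w + Z w)" for w
  have step_D: "step_fun N D"
    unfolding D_def
  proof (intro step_fun_prod step_fun_diff step_fun.const)
    fix i assume "i \<in> {..<m}"
    then have "d * Suc i + d \<le> N"
      unfolding N_def by (intro block_end_le) simp
    then show "step_fun N (\<lambda>w. q (block d w (Suc i)))"
      unfolding q_def by (intro step_fun_block step_fun_cell_fun)
  qed simp
  have step_Z: "step_fun N Z"
    unfolding Z_def using \<eta>
    by (intro step_fun_prod step_fun_diff step_fun.const step_fun.atom) auto
  have step_err: "step_fun N err"
    unfolding err_def by (intro step_fun_cmult step_fun.add step_D step_Z)
  have q: "q w = of_bool (\<forall>j<d. \<kappa> j = cell_index k (w j))" if "w \<in> cube d" for w
    unfolding q_def by (rule cell_fun_eq[OF k that])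
  have D: "D w = of_bool (\<forall>i<m. q (block d w (Suc i)) = 0)" if w: "w \<in> cube N" for w
  proof -
    have "1 - q (block d w (Suc i)) = of_bool (q (block d w (Suc i)) = 0)" if i: "i < m" for i
    proof -
      have "d * Suc i + d \<le> N"
        unfolding N_def by (rule block_end_le) (use i in simp)
      from q[OF block_in_cube[OF w this]] show ?thesis by simp
    qed
    then have "D w = (\<Prod>i<m. of_bool (q (block d w (Suc i)) = 0))"
      unfolding D_def by (intro prod.cong) auto
    then show ?thesis by (simp add: prod_of_bool)
  qed
  have Z: "Z w = of_bool (\<not> (\<forall>j<N. \<eta> \<le> w j \<and> w j < 1))" for w
  proof -
    have "of_bool (w j < 1) - of_bool (w j < \<eta>) = (of_bool (\<eta> \<le> w j \<and> w j < 1) :: real)" for j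
      using \<eta> by auto
    then show ?thesis by (simp add: Z_def prod_of_bool)
  qed
  have int_Z: "(\<integral>w. Z w \<partial>uniform_cube N) \<le> r"
  proof -
    interpret prob_space "uniform_cube N" by (rule prob_space_uniform_cube)
    let ?f = "\<lambda>j::nat. \<lambda>t. of_bool (t < 1) - of_bool (t < \<eta>) :: real"
    have int: "integrable unit_measure (?f j)" for j
      using \<eta> by (intro Bochner_Integration.integrable_diff integral_unit_below) auto
    have "(\<integral>w. (\<Prod>j<N. ?f j (w j)) \<partial>uniform_cube N) = (\<Prod>j<N. \<integral>t. ?f j t \<partial>unit_measure)"
      by (rule integral_uniform_cube_prod(1)[OF int])
    also have "\<dots> = (1 - \<eta>) ^ N"
      using \<eta> by (simp add: Bochner_Integration.integral_diff integral_unit_below)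
    finally have "(\<integral>w. Z w \<partial>uniform_cube N) = 1 - (1 - \<eta>) ^ N"
      unfolding Z_def using integral_uniform_cube_prod(2)[OF int] by (simp add: prob_space)
    also have "\<dots> \<le> real N * \<eta>"
      using Bernoulli_inequality[of "- \<eta>" N] \<eta> by simp
    also have "\<dots> \<le> r" using \<eta> by (simp add: mult.commute)
    finally show ?thesis .
  qed
  have int_q: "(\<integral>z. 1 - q z \<partial>uniform_cube d) = 1 - c"
  proof -
    interpret prob_space "uniform_cube d" by (rule prob_space_uniform_cube)
    show ?thesis
      using step_fun_integrable[OF step_fun_cell_fun[of d k \<kappa>]]
      by (simp add: q_def c_def integral_cell_fun[OF \<kappa>(1)] prob_space del: power_one_over)
  qed
  \<comment> \<open>The blocks are independent: the last factor depends on the last block alone and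
    the others on earlier ones, so each integration contributes \<open>1 - c\<close>.\<close>
  have int_D: "(\<integral>w. (\<Prod>i<n. 1 - q (block d w (Suc i))) \<partial>uniform_cube (d * (n + 1))) = (1 - c) ^ n" for n
  proof (induction n)
    case 0
    interpret prob_space "uniform_cube d" by (rule prob_space_uniform_cube)
    show ?case by (simp add: prob_space)
  next
    case (Suc n)
    let ?a = "d * (n + 1)"
    let ?D = "\<lambda>n w. \<Prod>i<n. 1 - q (block d w (Suc i))"
    have le: "d * Suc i + d \<le> d * (n + 1)" if "i < n" for i
      by (rule block_end_le[OF that])
    have "step_fun (?a + d) (?D (Suc n))"
    proof (intro step_fun_prod step_fun_diff step_fun.const)
      fix i assume "i \<in> {..<Suc n}"
      then have "d * Suc i + d \<le> ?a + d" by (cases "i = n") (use le[of i] in auto)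
      then show "step_fun (?a + d) (\<lambda>w. q (block d w (Suc i)))"
        unfolding q_def by (intro step_fun_block step_fun_cell_fun)
    qed simp
    then have "(\<integral>w. ?D (Suc n) w \<partial>uniform_cube (?a + d))
        = (\<integral>w. (\<integral>z. ?D (Suc n) (concat_point ?a d w z) \<partial>uniform_cube d) \<partial>uniform_cube ?a)"
      by (intro integral_concat_point step_fun_integrable)
    also have "\<dots> = (\<integral>w. (\<integral>z. ?D n w * (1 - q z) \<partial>uniform_cube d) \<partial>uniform_cube ?a)"
    proof (intro Bochner_Integration.integral_cong refl)
      fix w z assume "z \<in> space (uniform_cube d)"
      then have "block d (concat_point ?a d w z) (Suc n) = z"
        using block_concat_point_right[of z d "n + 1" w] by (simp add: space_uniform_cube)
      moreover have "?D n (concat_point ?a d w z) = ?D n w"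
        using le by (intro prod.cong) (auto simp: block_concat_point_left)
      ultimately show "?D (Suc n) (concat_point ?a d w z) = ?D n w * (1 - q z)"
        by simp
    qed
    also have "\<dots> = (\<integral>w. ?D n w * (1 - c) \<partial>uniform_cube ?a)"
      by (simp only: integral_mult_right_zero int_q)
    also have "\<dots> = (1 - c) ^ Suc n"
      using Suc.IH by (simp only: integral_mult_left_zero power_Suc2)
    finally show ?case by (simp add: add.commute)
  qed
  have int_err: "(\<integral>w. err w \<partial>uniform_cube N) \<le> e / 4"
  proof -
    have "(\<integral>w. err w \<partial>uniform_cube N) = 2 * B * ((\<integral>w. D w \<partial>uniform_cube N) + (\<integral>w. Z w \<partial>uniform_cube N))"
      using step_fun_integrable[OF step_D] step_fun_integrable[OF step_Z] by (simp add: err_def)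
    also have "(\<integral>w. D w \<partial>uniform_cube N) = (1 - c) ^ m"
      using int_D[of m] by (simp add: D_def N_def)
    also have "2 * B * ((1 - c) ^ m + (\<integral>w. Z w \<partial>uniform_cube N)) \<le> 2 * B * (r + r)"
      using m int_Z B(1) by (intro mult_left_mono add_mono) auto
    also have "\<dots> = e / 4" using B(1) by (simp add: r_def)
    finally show ?thesis .
  qed
  define G where "G w = (if restrict (block d w 0) {..<s} \<in> open_cube s
      then f (chentsov s F \<phi> (block d w) m) else 0)" for w
  obtain I where I: "has_riemann_integral N G I"
  proof -
    have "bounded (f ` \<Omega>)" using B(2) by (auto simp: bounded_iff)
    then have "riemann_integrable N G"
      using regular f unfolding regular_mcmc_def G_def[abs_def] N_def by blast
    then show thesis using that by (auto simp: riemann_integrable_def)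
  qed
  \<comment> \<open>The start varies with \<open>w\<close>, but coupling is applied at one fixed
    \<open>w\<close>, where \<open>x0 w\<close> is just another initial state.\<close>
  define x0 where "x0 w = chentsov s F \<phi> (block d w) 0" for w
  have x0: "x0 w \<in> \<Omega>" if "restrict (block d w 0) {..<s} \<in> open_cube s" for w
    using regular that by (simp add: x0_def regular_mcmc_def)
  have G_run: "G w = f (run \<phi> d (x0 w) w m)" if "restrict (block d w 0) {..<s} \<in> open_cube s" for w
    using that chentsov_eq_run[of s F \<phi> d w m] by (simp add: G_def x0_def)
  have mN: "d * m + d \<le> N" by (simp add: N_def)
  have G_bound: "\<bar>G w\<bar> \<le> B" if "w \<in> cube N" for w
  proof (cases "restrict (block d w 0) {..<s} \<in> open_cube s")
    case True
    then show ?thesis using G_run[OF True] B(2)[OF run_in[OF x0[OF True] that mN]] by simp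
  qed (use B(1) in \<open>simp add: G_def\<close>)
  have close: "\<bar>f (run \<phi> d x w m) - G w\<bar> \<le> err w" if x: "x \<in> \<Omega>" and w: "w \<in> cube N" for x w
  proof (cases "D w = 0 \<and> Z w = 0")
    case True
    then obtain i where i: "i < m" "q (block d w (Suc i)) \<noteq> 0"
      using D[OF w] by auto
    have inner: "0 < w j \<and> w j < 1" if "j < N" for j
    proof -
      have "\<eta> \<le> w j \<and> w j < 1" using True that unfolding Z by simp
      then show ?thesis using \<eta>(1) by linarith
    qed
    have "w j \<in> {0<..<1}" if "j < s" for j
      using inner[of j] that N(2) by simp
    then have opn: "restrict (block d w 0) {..<s} \<in> open_cube s"
      unfolding open_cube_def restrict_PiE_iff using s by (auto simp: block_def)
    have "d * Suc i + d \<le> N"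
      unfolding N_def by (rule block_end_le) (use i in simp)
    then have "block d w (Suc i) \<in> uniform_cell d k \<kappa>"
      using i(2) unfolding q_def by (intro cell_fun_in_cell[OF k] block_in_cube[OF w])
    then have "run \<phi> d x w m = run \<phi> d (x0 w) w m"
      using \<kappa>(2) i(1) by (intro run_coupled[OF C x x0[OF opn] w mN]) blast
    then show ?thesis using G_run[OF opn] True by (simp add: err_def)
  next
    case False
    have "0 \<le> D w" "0 \<le> Z w" "D w = 1 \<or> Z w = 1"
      using False D[OF w] Z[of w] by (auto split: if_splits)
    then have "1 \<le> D w + Z w" by linarith
    then have "2 * B \<le> err w" using B(1) by (simp add: err_def)
    moreover have "\<bar>f (run \<phi> d x w m)\<bar> \<le> B"
      by (rule B(2)[OF run_in[OF x w mN]])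
    ultimately show ?thesis using G_bound[OF w] by linarith
  qed
  \<comment> \<open>The losses add up to \<open>e\<close>: \<open>e / 4\<close> each for the upper
    and the lower step function, and \<open>e / 4\<close> twice for \<open>err\<close>.\<close>
  have e4: "e / 4 > 0" using e by simp
  obtain h where h: "step_fun N h" "\<And>w. w \<in> cube N \<Longrightarrow> G w \<le> h w"
    "(\<integral>w. h w \<partial>uniform_cube N) \<le> I + e / 4"
    using riemann_upper_step_fun[OF I G_bound e4] by metis
  obtain g where g: "step_fun N g" "\<And>w. w \<in> cube N \<Longrightarrow> g w \<le> G w"
    "I - e / 4 \<le> (\<integral>w. g w \<partial>uniform_cube N)"
    using riemann_lower_step_fun[OF I G_bound e4] by metis
  show thesis
  proof (rule that[of m, folded N_def])
    show "step_fun N (\<lambda>w. g w - err w)" by (intro step_fun_diff g step_err)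
    show "step_fun N (\<lambda>w. h w + err w)" by (intro step_fun.add h step_err)
    show "g w - err w \<le> f (run \<phi> d x w m) \<and> f (run \<phi> d x w m) \<le> h w + err w"
      if "x \<in> \<Omega>" "w \<in> cube N" for x w
      using close[OF that] g(2)[OF that(2)] h(2)[OF that(2)] by linarith
    have int: "integrable (uniform_cube N) g" "integrable (uniform_cube N) h" "integrable (uniform_cube N) err"
      by (intro step_fun_integrable g h step_err)+
    show "(\<integral>w. h w + err w \<partial>uniform_cube N) \<le> (\<integral>w. g w - err w \<partial>uniform_cube N) + e"
      using int int_err g(3) h(3) by simp
  qed
qed

end

section \<open>Consistency of the chain driven by a CUD sequence\<close>

theorem theorem2:
  fixes s d :: nat
    and \<Omega> :: "point set"
    and \<pi> :: "point \<Rightarrow> real"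
    and \<phi> :: "point \<Rightarrow> point \<Rightarrow> point"
    and F :: "nat \<Rightarrow> point \<Rightarrow> real \<Rightarrow> real"
    and C :: "point set"
    and v :: "nat \<Rightarrow> real"
    and u x :: "nat \<Rightarrow> point"
  assumes "1 \<le> s" and "s \<le> d"
    and "probability_density s \<Omega> \<pi>"
    and "regular_mcmc s d \<Omega> \<pi> \<phi> F"
    and "coupling_region d \<Omega> \<phi> C"
    and "x 0 \<in> \<Omega>"
    and "\<forall>i\<ge>1. x i = \<phi> (x (i - 1)) (u i)"
    and "cud v"
    and "\<forall>i\<ge>1. u i = (\<lambda>j\<in>{..<d}. v (d * (i - 1) + 1 + j))"
  shows "consistently_samples s \<Omega> \<pi> x"
proof -
  interpret mcmc s d \<Omega> \<pi> \<phi>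
    using assms(3,4) by unfold_locales (auto simp: regular_mcmc_def)
  have d: "d \<ge> 1" using assms(1,2) by simp
  have u: "u (Suc i) = window v d (d * i + 1)" for i
    using assms(9) by (simp add: window_def)
  have x_Suc: "x (Suc i) = \<phi> (x i) (u (Suc i))" for i
    using assms(7) by simp
  have x_in: "x i \<in> \<Omega>" for i
  proof (induction i)
    case (Suc i)
    then show ?case
      unfolding x_Suc u by (intro update_in window_in_cube[OF assms(8)]) simp_all
  qed (rule assms(6))
  have "avg (\<lambda>i. f (x i)) \<longlonglongrightarrow> (LINT y:\<Omega>|leb s. f y * \<pi> y)"
    if f: "continuous_on \<Omega> f" "bounded (f ` \<Omega>)" for f :: "point \<Rightarrow> real"
  proof -
    obtain B where B: "B > 0" "\<And>y. y \<in> \<Omega> \<Longrightarrow> \<bar>f y\<bar> \<le> B"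
      using f(2) unfolding bounded_pos by auto
    have f_meas: "f \<in> borel_measurable (state_space s \<Omega>)"
      by (rule borel_measurable_continuous_on_state[OF f(1)])
    have f_bd: "\<forall>y\<in>\<Omega>. \<bar>f y\<bar> \<le> B" using B(2) by blast
    define \<mu> where "\<mu> = (\<integral>y. f y \<partial>target s \<Omega> \<pi>)"
    have "avg (\<lambda>i. f (x i)) \<longlonglongrightarrow> \<mu>"
    proof (rule LIMSEQ_I)
      fix r :: real assume r: "0 < r"
      \<comment> \<open>One third each for equidistribution, the gap of the sandwich and the index
        shift.\<close>
      define e where "e = r / 3"
      have e: "e > 0" using r by (simp add: e_def)
      obtain m g h where gh: "step_fun (d * (m + 1)) g" "step_fun (d * (m + 1)) h"
        and sandwich: "\<And>y w. y \<in> \<Omega> \<Longrightarrow> w \<in> cube (d * (m + 1)) \<Longrightarrow>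
            g w \<le> f (run \<phi> d y w m) \<and> f (run \<phi> d y w m) \<le> h w"
        and close: "(\<integral>w. h w \<partial>uniform_cube (d * (m + 1))) \<le> (\<integral>w. g w \<partial>uniform_cube (d * (m + 1))) + e"
        using run_sandwich[OF assms(4,5,1,2) f(1) B e] by metis
      define N where "N = d * (m + 1)"
      have N: "N \<ge> 1" "d * m + d \<le> N" using d by (auto simp: N_def)
      note gh = gh[folded N_def] and sandwich = sandwich[folded N_def] and close = close[folded N_def]
      let ?Ig = "\<integral>w. g w \<partial>uniform_cube N" and ?Ih = "\<integral>w. h w \<partial>uniform_cube N"
      have run_int: "?Ig \<le> (\<integral>w. f (run \<phi> d y w m) \<partial>uniform_cube N)"
        "(\<integral>w. f (run \<phi> d y w m) \<partial>uniform_cube N) \<le> ?Ih" if y: "y \<in> \<Omega>" for y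
        using sandwich[OF y] integrable_run[OF f_meas f_bd y N(2)] step_fun_integrable[OF gh(1)]
          step_fun_integrable[OF gh(2)]
        by (auto intro!: integral_mono simp: space_uniform_cube)
      \<comment> \<open>The bounds hold for every initial state, hence also after averaging over the
        target, where stationarity identifies the middle term with \<open>\<mu>\<close>.\<close>
      have "?Ig \<le> \<mu> \<and> \<mu> \<le> ?Ih"
      proof -
        interpret T: prob_space "target s \<Omega> \<pi>" by (rule prob_space_target)
        interpret U: prob_space "uniform_cube N" by (rule prob_space_uniform_cube)
        interpret TU: pair_sigma_finite "target s \<Omega> \<pi>" "uniform_cube N" ..
        let ?H = "\<lambda>y. \<integral>w. f (run \<phi> d y w m) \<partial>uniform_cube N"
        have "(\<lambda>(y, w). f (run \<phi> d y w m)) \<in> borel_measurable (state_space s \<Omega> \<Otimes>\<^sub>M uniform_cube N)"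
          using measurable_compose[OF measurable_run[OF N(2)] f_meas] by (simp add: split_beta')
        then have H: "?H \<in> borel_measurable (state_space s \<Omega>)"
          by (rule U.borel_measurable_lebesgue_integral)
        have "integrable (target s \<Omega> \<pi>) ?H"
          by (rule integrable_target[OF H, of "\<bar>?Ig\<bar> + \<bar>?Ih\<bar>"]) (use run_int in \<open>force simp: abs_le_iff\<close>)
        then have "?Ig \<le> (\<integral>y. ?H y \<partial>target s \<Omega> \<pi>)" "(\<integral>y. ?H y \<partial>target s \<Omega> \<pi>) \<le> ?Ih"
          using run_int by (auto intro!: T.integral_ge_const T.integral_le_const AE_I2 simp: space_target)
        then show ?thesis
          using integral_run[OF f_meas f_bd, of m] by (simp add: \<mu>_def N_def)
      qed
      \<comment> \<open>For \<open>i \<ge> 1\<close> the blocks \<open>0, ..., m\<close> of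
        \<open>y i\<close> are \<open>u i, ..., u (i + m)\<close>. For \<open>i = 0\<close>
        truncated subtraction gives the window at 1, which is still in the cube.\<close>
      define y where "y i = window v N (d * (i - 1) + 1)" for i
      have y: "y i \<in> cube N" for i
        unfolding y_def by (rule window_in_cube[OF assms(8)]) simp
      \<comment> \<open>The initial state \<open>x i\<close> depends on the past of the sequence,
        including block 0 of \<open>y i\<close>. This is harmless because the sandwich is uniform in
        the initial state.\<close>
      have x_run: "x (i + m) = run \<phi> d (x i) (y i) m" if i: "i \<ge> 1" for i
      proof -
        have "x (i + j) = run \<phi> d (x i) (y i) j" if "j \<le> m" for j
          using that
        proof (induction j)
          case (Suc j)
          have "d * Suc j + d \<le> N"
            using block_end_le[of j m d] Suc.prems by (simp add: N_def)
          moreover have "d * (i + j) + 1 = d * (i - 1) + 1 + d * Suc j"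
            using i by (cases i) (auto simp: algebra_simps)
          ultimately have "block d (y i) (Suc j) = u (Suc (i + j))"
            unfolding u by (auto simp: block_def y_def window_def fun_eq_iff add.assoc)
          then show ?case using Suc x_Suc[of "i + j"] by simp
        qed simp
        then show ?thesis by simp
      qed
      have lim: "avg (\<lambda>i. g (y i)) \<longlonglongrightarrow> ?Ig" "avg (\<lambda>i. h (y i)) \<longlonglongrightarrow> ?Ih"
        using cud_equidistributed[OF assms(8) N(1) d gh(1)] cud_equidistributed[OF assms(8) N(1) d gh(2)]
        by (simp_all add: equidistributed_def y_def)
      \<comment> \<open>The sandwich controls states \<open>m\<close> steps ahead; averages of
        bounded values do not notice the delay in the limit.\<close>
      have shift: "(\<lambda>n. avg (\<lambda>i. f (x (i + m))) n - avg (\<lambda>i. f (x i)) n) \<longlonglongrightarrow> 0"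
        using f_bd x_in by (intro avg_shift_diff[where B=B]) auto
      have avg_bounds: "avg (\<lambda>i. g (y i)) n \<le> avg (\<lambda>i. f (x (i + m))) n"
        "avg (\<lambda>i. f (x (i + m))) n \<le> avg (\<lambda>i. h (y i)) n" for n
        using sandwich[OF x_in y] by (auto intro!: avg_mono simp: x_run)
      have "\<forall>\<^sub>F n in sequentially. avg (\<lambda>i. g (y i)) n > ?Ig - e"
        by (rule order_tendstoD(1)[OF lim(1)]) (use e in simp)
      moreover have "\<forall>\<^sub>F n in sequentially. avg (\<lambda>i. h (y i)) n < ?Ih + e"
        by (rule order_tendstoD(2)[OF lim(2)]) (use e in simp)
      moreover have "\<forall>\<^sub>F n in sequentially. avg (\<lambda>i. f (x (i + m))) n - avg (\<lambda>i. f (x i)) n < e"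
        by (rule order_tendstoD(2)[OF shift e])
      moreover have "\<forall>\<^sub>F n in sequentially. avg (\<lambda>i. f (x (i + m))) n - avg (\<lambda>i. f (x i)) n > - e"
        by (rule order_tendstoD(1)[OF shift]) (use e in simp)
      ultimately have "\<forall>\<^sub>F n in sequentially. norm (avg (\<lambda>i. f (x i)) n - \<mu>) < r"
      proof eventually_elim
        case (elim n)
        have "r = 3 * e" by (simp add: e_def)
        then have "\<bar>avg (\<lambda>i. f (x i)) n - \<mu>\<bar> < r"
          using elim avg_bounds[of n] close \<open>?Ig \<le> \<mu> \<and> \<mu> \<le> ?Ih\<close> by linarith
        then show ?case by simp
      qed
      then show "\<exists>no. \<forall>n\<ge>no. norm (avg (\<lambda>i. f (x i)) n - \<mu>) < r"
        by (simp add: eventually_sequentially)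
    qed
    then show ?thesis by (simp only: integral_target[OF f_meas] \<mu>_def)
  qed
  then show ?thesis
    unfolding consistently_samples_def avg_def[abs_def] using x_in by blast
qed

end
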